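(* Let $f(x)\in\mathbb{Z}[x]$ be a monic, squarefree polynomial with roots $\beta_1,\dots,\beta_k\in\mathbb{C}$. If $n$ is a Frobenius pseudoprime with respect to $f(x)$, then $n$ is a pseudoprime in the sense of Szekeres with respect to $f$, i.e. for every symmetric polynomial $S(x_1,\dots,x_k)\in\mathbb{Z}[x_1,\dots,x_k]$ one has $S(\beta_1^n,\dots,\beta_k^n)\equiv S(\beta_1,\dots,\beta_k)\pmod n$.
   Context: Both sides of the congruence are integers, since they are symmetric integer polynomial expressions in the roots of a monic integer polynomial. For monic polynomials $g_1,g_2$ over a commutative ring $R$ with identity, a monic $h\in R[x]$ is $\operatorname{gcmd}(g_1,g_2)$ if the ideal generated by $g_1,g_2$ equals the ideal generated by $h$ (it may fail to exist). Let $f(x)\in\mathbb{Z}[x]$ be monic of degree $d$ with discriminant $\Delta$. An odd integer $n>1$ is a Frobenius probable prime with respect to $f$ if $\gcd(n,f(0)\Delta)=1$ and, with all computations in $(\mathbb{Z}/n\mathbb{Z})[x]$: (Factorization) setting $f_0=f\bmod n$ and, for $1\le i\le d$, $F_i=\operatorname{gcmd}(x^{n^i}-x,f_{i-1})$ and $f_i=f_{i-1}/F_i$, all these gcmds exist and $f_d=1$; (Frobenius) for $2\le i\le d$, $F_i(x^n)\equiv 0\pmod{F_i(x)}$; (Jacobi) with $S=\sum_{2\mid i}\deg(F_i)/i$, one has $(-1)^S=\left(\frac{\Delta}{n}\right)$ (Jacobi symbol). A Frobenius pseudoprime with respect to $f$ is a composite Frobenius probable prime with respect to $f$. *)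

theory Defs
  imports
    Complex_Main
    "HOL-Computational_Algebra.Squarefree"
    "HOL-Library.Poly_Mapping"
    "HOL-Number_Theory.Residues"
    "HOL-Algebra.UnivPoly"
    "HOL-Algebra.Divisibility"
    "Subresultants.Resultant_Prelim"
begin

section \<open>Univariate polynomials over a ring of the algebra library\<close>

definition up_monic :: "('a, 'm) ring_scheme \<Rightarrow> (nat \<Rightarrow> 'a) \<Rightarrow> bool" where
  "up_monic R p \<longleftrightarrow>
     p \<in> carrier (UP R) \<and> UnivPoly.coeff (UP R) p (deg R p) = \<one>\<^bsub>R\<^esub>"

text \<open>A relation rather than a function, since a gcmd may fail to exist. It is unique when it
  does exist: two monic polynomials generating the same ideal are equal.\<close>

definition is_gcmd ::
  "('a, 'm) ring_scheme \<Rightarrow> (nat \<Rightarrow> 'a) \<Rightarrow> (nat \<Rightarrow> 'a) \<Rightarrow> (nat \<Rightarrow> 'a) \<Rightarrow> bool" where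
  "is_gcmd R g1 g2 h \<longleftrightarrow> up_monic R h \<and> Idl\<^bsub>UP R\<^esub> {g1, g2} = Idl\<^bsub>UP R\<^esub> {h}"

definition up_compose :: "('a, 'm) ring_scheme \<Rightarrow> (nat \<Rightarrow> 'a) \<Rightarrow> (nat \<Rightarrow> 'a) \<Rightarrow> (nat \<Rightarrow> 'a)" where
  "up_compose R p q = eval R (UP R) (\<lambda>a. UnivPoly.monom (UP R) a 0) q p"

text \<open>An element of \<open>UP R\<close> is its own coefficient sequence, and \<open>residue_ring n\<close> has carrier
  \<open>{0..n - 1}\<close>; so this is the image of \<open>f\<close> in the polynomial ring over the integers mod \<open>n\<close>.\<close>

definition reduce_poly :: "nat \<Rightarrow> int poly \<Rightarrow> (nat \<Rightarrow> int)" where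
  "reduce_poly n f = (\<lambda>i. Polynomial.coeff f i mod int n)"

lemma reduce_poly_carrier:
  assumes "n > 0"
  shows "reduce_poly n f \<in> carrier (UP (residue_ring (int n)))"
proof -
  have "bound 0 (Polynomial.degree f) (reduce_poly n f)"
    by (auto intro!: bound.intro simp: reduce_poly_def Polynomial.coeff_eq_0)
  then show ?thesis
    using assms by (auto simp: UP_def up_def residue_ring_def reduce_poly_def)
qed


section \<open>Frobenius pseudoprimes\<close>

definition discriminant :: "int poly \<Rightarrow> int" where
  "discriminant f =
     (let d = Polynomial.degree f
      in (- 1) ^ (d * (d - 1) div 2) * resultant f (pderiv f) div lead_coeff f)"

definition Jacobi :: "int \<Rightarrow> nat \<Rightarrow> int" where
  "Jacobi a n = (\<Prod>p\<in>#prime_factorization n. Legendre a (int p))"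

text \<open>\<open>fs i\<close> is the quotient of \<open>fs (i - 1)\<close> by \<open>F i\<close>; it is determined by the product equation
  because \<open>F i\<close> is monic. Only \<open>F 1, \<dots>, F d\<close> and \<open>fs 0, \<dots>, fs d\<close> matter.\<close>

definition factorization_step ::
  "int poly \<Rightarrow> nat \<Rightarrow> (nat \<Rightarrow> nat \<Rightarrow> int) \<Rightarrow> (nat \<Rightarrow> nat \<Rightarrow> int) \<Rightarrow> bool" where
  "factorization_step f n F fs \<longleftrightarrow>
     (let R = residue_ring (int n); P = UP R; X = UnivPoly.monom P \<one>\<^bsub>R\<^esub>; d = Polynomial.degree f
      in fs 0 = reduce_poly n f \<and>
         (\<forall>i\<in>{1..d}. is_gcmd R (X (n ^ i) \<ominus>\<^bsub>P\<^esub> X 1) (fs (i - 1)) (F i) \<and>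
                     fs i \<in> carrier P \<and> fs (i - 1) = F i \<otimes>\<^bsub>P\<^esub> fs i) \<and>
         fs d = \<one>\<^bsub>P\<^esub>)"

definition frobenius_step :: "int poly \<Rightarrow> nat \<Rightarrow> (nat \<Rightarrow> nat \<Rightarrow> int) \<Rightarrow> bool" where
  "frobenius_step f n F \<longleftrightarrow>
     (let R = residue_ring (int n); P = UP R
      in \<forall>i\<in>{2..Polynomial.degree f}.
           F i divides\<^bsub>P\<^esub> up_compose R (F i) (UnivPoly.monom P \<one>\<^bsub>R\<^esub> n))"

text \<open>The exponent is formed as a rational number; that it is a natural number is part of
  the condition.\<close>

definition jacobi_step :: "int poly \<Rightarrow> nat \<Rightarrow> (nat \<Rightarrow> nat \<Rightarrow> int) \<Rightarrow> bool" where
  "jacobi_step f n F \<longleftrightarrow>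
     (\<exists>S::nat.
        of_nat S = (\<Sum>i | i \<in> {1..Polynomial.degree f} \<and> even i.
                      of_nat (deg (residue_ring (int n)) (F i)) / of_nat i :: rat) \<and>
        (- 1) ^ S = Jacobi (discriminant f) n)"

definition frobenius_probable_prime :: "int poly \<Rightarrow> nat \<Rightarrow> bool" where
  "frobenius_probable_prime f n \<longleftrightarrow>
     odd n \<and> n > 1 \<and> coprime (int n) (poly f 0 * discriminant f) \<and>
     (\<exists>F fs. factorization_step f n F fs \<and> frobenius_step f n F \<and> jacobi_step f n F)"

definition frobenius_pseudoprime :: "int poly \<Rightarrow> nat \<Rightarrow> bool" where
  "frobenius_pseudoprime f n \<longleftrightarrow> frobenius_probable_prime f n \<and> \<not> Factorial_Ring.prime n"


section \<open>Symmetric polynomials and Szekeres pseudoprimes\<close>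

text \<open>A multivariate integer polynomial is a finitely supported map from monomials to
  coefficients, a monomial being a finitely supported map from variable indices to exponents.\<close>

type_synonym int_mpoly = "(nat \<Rightarrow>\<^sub>0 nat) \<Rightarrow>\<^sub>0 int"

definition mpoly_vars :: "int_mpoly \<Rightarrow> nat set" where
  "mpoly_vars S = (\<Union>m\<in>Poly_Mapping.keys S. Poly_Mapping.keys m)"

definition mpoly_eval :: "(nat \<Rightarrow> complex) \<Rightarrow> int_mpoly \<Rightarrow> complex" where
  "mpoly_eval x S =
     (\<Sum>m\<in>Poly_Mapping.keys S.
        of_int (Poly_Mapping.lookup S m) *
        (\<Prod>i\<in>Poly_Mapping.keys m. x i ^ Poly_Mapping.lookup m i))"

text \<open>The coefficient of \<open>m\<close> in \<open>permute_vars \<pi> S\<close> is that of \<open>m \<circ> \<pi>\<close> in \<open>S\<close>, so this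
  substitutes the variable with index \<open>\<pi> i\<close> for the one with index \<open>i\<close>, for bijective \<open>\<pi>\<close>.\<close>

definition permute_vars :: "(nat \<Rightarrow> nat) \<Rightarrow> int_mpoly \<Rightarrow> int_mpoly" where
  "permute_vars \<pi> S = Poly_Mapping.map_key (Poly_Mapping.map_key \<pi>) S"

definition symmetric_mpoly :: "nat \<Rightarrow> int_mpoly \<Rightarrow> bool" where
  "symmetric_mpoly k S \<longleftrightarrow>
     mpoly_vars S \<subseteq> {1..k} \<and> (\<forall>\<pi>. \<pi> permutes {1..k} \<longrightarrow> permute_vars \<pi> S = S)"

text \<open>Here \<open>\<beta> 1, \<dots>, \<beta> k\<close> are the complex roots of the polynomial in question. Both values
  being integers is part of the statement.\<close>

definition szekeres_pseudoprime :: "nat \<Rightarrow> (nat \<Rightarrow> complex) \<Rightarrow> nat \<Rightarrow> bool" where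
  "szekeres_pseudoprime k \<beta> n \<longleftrightarrow>
     (\<forall>S. symmetric_mpoly k S \<longrightarrow>
        (\<exists>a b :: int. mpoly_eval (\<lambda>i. \<beta> i ^ n) S = of_int a \<and> mpoly_eval \<beta> S = of_int b \<and>
                      [a = b] (mod int n)))"

end

theory Submission
  imports
    Defs
    "HOL-Computational_Algebra.Fundamental_Theorem_Algebra"
begin

text \<open>For monic \<open>G\<close> and \<open>h\<close> with coefficients in \<open>\<int>[t]\<close>, let \<open>N G h\<close> be the determinant of
  multiplication by \<open>h\<close> on \<open>\<int>[t][x]/(G)\<close>. It equals the product of \<open>h \<gamma>\<close> over the roots \<open>\<gamma>\<close> of
  \<open>G\<close>, hence is multiplicative in \<open>G\<close>, and modulo \<open>n\<close> it depends only on \<open>G\<close> modulo \<open>n\<close>. If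
  \<open>G(x^n)\<close> and \<open>x^(n^i) - x\<close> lie in the ideal \<open>(G, n)\<close>, then \<open>x \<mapsto> x^n\<close> induces an automorphism of
  the quotient by that ideal which conjugates multiplication by \<open>h(x)\<close> into multiplication by
  \<open>h(x^n)\<close>, so \<open>N G (h(x))\<close> and \<open>N G (h(x^n))\<close> agree modulo \<open>n\<close>. The factors \<open>F\<^sub>i\<close> of a Frobenius
  probable prime lift to such \<open>G\<close>, so the products of \<open>h(\<beta>\<^sub>i)\<close> and of \<open>h(\<beta>\<^sub>i^n)\<close> over the roots of
  \<open>f\<close> are congruent polynomials in \<open>t\<close>. For \<open>h = \<Sum>j. t^(B^j) x^j\<close> with \<open>B\<close> large, the coefficients
  of such products are the monomial symmetric functions of the roots, and these span all
  symmetric polynomials.\<close>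


section \<open>Matrices of maps on a quotient of a polynomial ring\<close>

text \<open>The modulus \<open>m\<close> is a scalar, so this is congruence modulo the ideal
  \<open>(G, m)\<close>, stated with explicit cofactors so that no quotient ring has to be built.
  Taking \<open>m = 0\<close> gives congruence modulo \<open>G\<close>.\<close>

definition ideal_cong :: "'a::idom \<Rightarrow> 'a poly \<Rightarrow> 'a poly \<Rightarrow> 'a poly \<Rightarrow> bool" where
  "ideal_cong m G p q \<longleftrightarrow> (\<exists>u v. p - q = G * u + Polynomial.smult m v)"

lemma ideal_congI: "p - q = G * u + Polynomial.smult m v \<Longrightarrow> ideal_cong m G p q"
  unfolding ideal_cong_def by blast

lemma ideal_cong_refl [simp]: "ideal_cong m G p p"
  by (rule ideal_congI[of _ _ _ 0 _ 0]) simp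

lemma ideal_cong_sym: "ideal_cong m G p q \<Longrightarrow> ideal_cong m G q p"
proof -
  assume "ideal_cong m G p q"
  then obtain u v where "p - q = G * u + Polynomial.smult m v" unfolding ideal_cong_def by blast
  then have "q - p = G * (- u) + Polynomial.smult m (- v)"
    by (metis minus_add_distrib minus_diff_eq mult_minus_right smult_minus_right)
  then show ?thesis by (rule ideal_congI)
qed

lemma ideal_cong_add:
  assumes "ideal_cong m G p q" "ideal_cong m G p' q'"
  shows "ideal_cong m G (p + p') (q + q')"
proof -
  obtain u v u' v' where "p - q = G * u + Polynomial.smult m v" "p' - q' = G * u' + Polynomial.smult m v'"
    using assms unfolding ideal_cong_def by blast
  then have "p + p' - (q + q') = G * (u + u') + Polynomial.smult m (v + v')"
    by (simp add: algebra_simps smult_add_right)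
  then show ?thesis by (rule ideal_congI)
qed

lemma ideal_cong_trans:
  assumes "ideal_cong m G p q" "ideal_cong m G q r"
  shows "ideal_cong m G p r"
  using ideal_cong_add[OF assms] ideal_congI[of "p" "r"] unfolding ideal_cong_def by simp

lemma ideal_cong_mult_left:
  assumes "ideal_cong m G p q"
  shows "ideal_cong m G (h * p) (h * q)"
proof -
  obtain u v where "p - q = G * u + Polynomial.smult m v"
    using assms unfolding ideal_cong_def by blast
  then have "h * p - h * q = G * (h * u) + Polynomial.smult m (h * v)"
    by (metis mult.left_commute mult_smult_right right_diff_distrib ring_class.ring_distribs(1))
  then show ?thesis by (rule ideal_congI)
qed

lemma ideal_cong_smult:
  "ideal_cong m G p q \<Longrightarrow> ideal_cong m G (Polynomial.smult c p) (Polynomial.smult c q)"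
  using ideal_cong_mult_left[of m G p q "[:c:]"] by simp

lemma ideal_cong_sum:
  assumes "\<And>i. i \<in> A \<Longrightarrow> ideal_cong m G (p i) (q i)"
  shows "ideal_cong m G (sum p A) (sum q A)"
  using assms by (induction A rule: infinite_finite_induct) (auto intro: ideal_cong_add)

lemma ideal_cong_power:
  assumes "ideal_cong m G p q"
  shows "ideal_cong m G (p ^ k) (q ^ k)"
proof (induction k)
  case (Suc k)
  have "ideal_cong m G (p * p ^ k) (p * q ^ k)" using Suc by (rule ideal_cong_mult_left)
  moreover have "ideal_cong m G (q ^ k * p) (q ^ k * q)" using assms by (rule ideal_cong_mult_left)
  ultimately show ?case by (simp add: mult.commute) (rule ideal_cong_trans)
qed simp

text \<open>Over a domain the division works because \<open>G\<close> is monic; the coefficients of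
  \<open>p\<close> are brought in one at a time, as in Horner's scheme.\<close>

lemma monic_division:
  fixes G :: "'a::idom poly"
  assumes "lead_coeff G = 1" "Polynomial.degree G > 0"
  shows "\<exists>u r. p = G * u + r \<and> Polynomial.degree r < Polynomial.degree G"
proof (induction p)
  case 0
  show ?case using assms by (intro exI[of _ 0]) simp
next
  case (pCons a p)
  then obtain u r where ur: "p = G * u + r" "Polynomial.degree r < Polynomial.degree G" by blast
  define d where "d = Polynomial.degree G"
  \<comment> \<open>Shifting \<open>r\<close> moves its coefficient in degree \<open>d - 1\<close>
    to degree \<open>d\<close>; subtracting \<open>c\<close> times the monic \<open>G\<close>
    cancels it.\<close>
  define c where "c = Polynomial.coeff r (d - 1)"
  define r' where "r' = pCons a r - Polynomial.smult c G"
  have "pCons a p = G * (pCons 0 u + [:c:]) + r'"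
    unfolding r'_def by (simp add: ur(1) algebra_simps)
  moreover have "Polynomial.degree r' < d"
  proof -
    have "Polynomial.degree r' \<le> d - 1"
    proof (rule degree_le, intro allI impI)
      fix i assume "d - 1 < i"
      then consider "i = d" | "i > d" by linarith
      then show "Polynomial.coeff r' i = 0"
      proof cases
        case 1
        then show ?thesis using assms unfolding r'_def c_def d_def
          by (cases "Polynomial.degree G") (auto simp: coeff_pCons)
      next
        case 2
        then show ?thesis using ur(2) unfolding r'_def d_def
          by (cases i) (auto simp: Polynomial.coeff_eq_0)
      qed
    qed
    then show ?thesis using assms d_def by simp
  qed
  ultimately show ?case unfolding d_def by blast
qed

text \<open>Reducing the cofactor of \<open>m\<close> modulo \<open>G\<close> leaves a multiple of
  \<open>G\<close> of smaller degree, hence zero, so \<open>p\<close> is \<open>m\<close> times a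
  polynomial. This makes remainders unique modulo \<open>m\<close>.\<close>

lemma ideal_cong_0_imp_dvd_coeff:
  fixes G :: "'a::idom poly"
  assumes "lead_coeff G = 1" "Polynomial.degree p < Polynomial.degree G" "ideal_cong m G p 0"
  shows "m dvd Polynomial.coeff p r"
proof -
  obtain u v where p: "p = G * u + Polynomial.smult m v"
    using assms(3) unfolding ideal_cong_def by auto
  obtain w q where v: "v = G * w + q" "Polynomial.degree q < Polynomial.degree G"
    using monic_division[OF assms(1), of v] assms(2) by auto
  have eq: "p - Polynomial.smult m q = G * (u + Polynomial.smult m w)"
    by (simp add: p v(1) algebra_simps smult_add_right)
  have "Polynomial.degree (p - Polynomial.smult m q) < Polynomial.degree G"
    using assms(2) v(2) by (meson degree_diff_less degree_smult_le le_less_trans)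
  then have "u + Polynomial.smult m w = 0"
    using eq by (metis degree_mult_right_le leD mult_zero_left mult_eq_0_iff)
  then have "p = Polynomial.smult m q" using eq by simp
  then show ?thesis by simp
qed

section \<open>Matrices in the power basis of the quotient\<close>

text \<open>A column holds coordinates in the power basis; read as a polynomial, it can be compared
  with the image of a basis element.\<close>

definition col_poly :: "'a::idom mat \<Rightarrow> nat \<Rightarrow> 'a poly" where
  "col_poly M s = (\<Sum>r<dim_row M. Polynomial.monom (M $$ (r, s)) r)"

lemma coeff_col_poly:
  "Polynomial.coeff (col_poly M s) r = (if r < dim_row M then M $$ (r, s) else 0)"
  unfolding col_poly_def by (simp add: Polynomial.coeff_sum Polynomial.coeff_monom)

lemma degree_col_poly:
  "dim_row M > 0 \<Longrightarrow> Polynomial.degree (col_poly M s) < dim_row M"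
  by (rule degree_lessI) (auto simp: coeff_col_poly)

lemma col_poly_mult:
  assumes "M \<in> carrier_mat d d" "N \<in> carrier_mat d d" "s < d"
  shows "col_poly (M * N) s = (\<Sum>r<d. Polynomial.smult (N $$ (r, s)) (col_poly M r))"
proof (rule poly_eqI)
  fix i
  show "Polynomial.coeff (col_poly (M * N) s) i
      = Polynomial.coeff (\<Sum>r<d. Polynomial.smult (N $$ (r, s)) (col_poly M r)) i"
    using assms
    by (auto simp: coeff_col_poly Polynomial.coeff_sum scalar_prod_def mult.commute
        lessThan_atLeast0 intro!: sum.cong)
qed

lemma col_poly_one: "s < d \<Longrightarrow> col_poly (1\<^sub>m d) s = Polynomial.monom 1 s"
  by (rule poly_eqI) (auto simp: coeff_col_poly Polynomial.coeff_monom)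

text \<open>\<open>L\<close> acts on polynomials themselves; the last clause is what lets it descend
  to the quotient by \<open>(G, m)\<close>.\<close>

definition ideal_linear :: "'a::idom \<Rightarrow> 'a poly \<Rightarrow> ('a poly \<Rightarrow> 'a poly) \<Rightarrow> bool" where
  "ideal_linear m G L \<longleftrightarrow>
     (\<forall>p q. L (p + q) = L p + L q) \<and> (\<forall>c p. L (Polynomial.smult c p) = Polynomial.smult c (L p)) \<and>
     (\<forall>p q. ideal_cong m G p q \<longrightarrow> ideal_cong m G (L p) (L q))"

text \<open>\<open>M\<close> is the matrix, in the basis \<open>1, x, \<dots>, x^(d - 1)\<close>, of the map induced by \<open>L\<close> on the
  quotient by \<open>(G, m)\<close>; for \<open>m = 0\<close> this is the quotient by \<open>G\<close> alone, and divisibility by \<open>m\<close>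
  below becomes equality.\<close>

definition represents ::
  "'a::idom \<Rightarrow> 'a poly \<Rightarrow> ('a poly \<Rightarrow> 'a poly) \<Rightarrow> 'a mat \<Rightarrow> bool" where
  "represents m G L M \<longleftrightarrow>
     M \<in> carrier_mat (Polynomial.degree G) (Polynomial.degree G) \<and>
     (\<forall>s<Polynomial.degree G. ideal_cong m G (col_poly M s) (L (Polynomial.monom 1 s)))"

lemma ideal_linear_sum:
  assumes "ideal_linear m G L"
  shows "L (\<Sum>i\<in>A. Polynomial.smult (c i) (p i)) = (\<Sum>i\<in>A. Polynomial.smult (c i) (L (p i)))"
proof -
  have "L 0 = Polynomial.smult 0 (L 0)" using assms unfolding ideal_linear_def by (metis smult_0_left)
  then show ?thesis using assms
    by (induction A rule: infinite_finite_induct) (auto simp: ideal_linear_def)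
qed

lemma col_poly_alt:
  "col_poly M s = (\<Sum>r<dim_row M. Polynomial.smult (M $$ (r, s)) (Polynomial.monom 1 r))"
  unfolding col_poly_def by (simp add: smult_monom)

text \<open>Column \<open>s\<close> of the product combines the columns of \<open>M\<close> with the
  entries of column \<open>s\<close> of \<open>M'\<close>. Linearity turns this into
  \<open>L\<close> applied to the latter column, and \<open>L\<close> respects the congruence
  between that column and \<open>L'\<close> of \<open>x^s\<close>.\<close>

lemma represents_mult:
  assumes "represents m G L M" "represents m G L' M'" "ideal_linear m G L"
  shows "represents m G (L \<circ> L') (M * M')"
  unfolding represents_def
proof (intro conjI allI impI)
  let ?d = "Polynomial.degree G"
  have c: "M \<in> carrier_mat ?d ?d" "M' \<in> carrier_mat ?d ?d" using assms unfolding represents_def by auto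
  then show "M * M' \<in> carrier_mat ?d ?d" by simp
  fix s assume s: "s < ?d"
  have "ideal_cong m G (\<Sum>r<?d. Polynomial.smult (M' $$ (r, s)) (col_poly M r))
      (\<Sum>r<?d. Polynomial.smult (M' $$ (r, s)) (L (Polynomial.monom 1 r)))"
    using assms(1) unfolding represents_def by (intro ideal_cong_sum ideal_cong_smult) auto
  also have "(\<Sum>r<?d. Polynomial.smult (M' $$ (r, s)) (L (Polynomial.monom 1 r))) = L (col_poly M' s)"
    using c by (simp add: col_poly_alt ideal_linear_sum[OF assms(3)])
  finally have "ideal_cong m G (col_poly (M * M') s) (L (col_poly M' s))"
    using col_poly_mult[OF c s] by simp
  moreover have "ideal_cong m G (L (col_poly M' s)) (L (L' (Polynomial.monom 1 s)))"
    using assms(2,3) s unfolding represents_def ideal_linear_def by blast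
  ultimately show "ideal_cong m G (col_poly (M * M') s) ((L \<circ> L') (Polynomial.monom 1 s))"
    unfolding comp_def by (rule ideal_cong_trans)
qed

text \<open>Columns are polynomials of degree below that of \<open>G\<close>, so congruent columns
  have entries that agree modulo \<open>m\<close>.\<close>

lemma represents_unique:
  assumes "lead_coeff G = 1" "represents m G L M" "represents m G L' M'"
    and "\<And>s. s < Polynomial.degree G \<Longrightarrow>
           ideal_cong m G (L (Polynomial.monom 1 s)) (L' (Polynomial.monom 1 s))"
    and "r < Polynomial.degree G" "s < Polynomial.degree G"
  shows "m dvd M $$ (r, s) - M' $$ (r, s)"
proof -
  let ?d = "Polynomial.degree G"
  have c: "M \<in> carrier_mat ?d ?d" "M' \<in> carrier_mat ?d ?d" using assms unfolding represents_def by auto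
  have "ideal_cong m G (col_poly M s) (col_poly M' s)"
    using assms(2-) ideal_cong_trans ideal_cong_sym unfolding represents_def by meson
  then have "ideal_cong m G (col_poly M s - col_poly M' s) 0"
    unfolding ideal_cong_def by simp
  moreover have "Polynomial.degree (col_poly M s - col_poly M' s) < ?d"
    using c degree_col_poly[of M s] degree_col_poly[of M' s] assms(5)
    by (intro degree_diff_less) auto
  ultimately have "m dvd Polynomial.coeff (col_poly M s - col_poly M' s) r"
    using ideal_cong_0_imp_dvd_coeff[OF assms(1)] by blast
  then show ?thesis using c assms(5) by (simp add: coeff_col_poly)
qed

lemma represents_exists:
  assumes "lead_coeff G = 1"
  shows "\<exists>M. represents m G L M"
proof (cases "Polynomial.degree G = 0")
  case True
  \<comment> \<open>In degree 0 the basis is empty and the matrix is 0 by 0; the division used below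
    assumes positive degree.\<close>
  then show ?thesis unfolding represents_def by (intro exI[of _ "1\<^sub>m 0"]) simp
next
  case False
  let ?d = "Polynomial.degree G"
  have "\<forall>s. \<exists>r u. L (Polynomial.monom 1 s) = G * u + r \<and> Polynomial.degree r < ?d"
    using monic_division[OF assms] False by blast
  then obtain r u where ru: "\<And>s. L (Polynomial.monom 1 s) = G * u s + r s"
      "\<And>s. Polynomial.degree (r s) < ?d" by metis
  define M where "M = mat ?d ?d (\<lambda>(i, s). Polynomial.coeff (r s) i)"
  have M: "M \<in> carrier_mat ?d ?d" unfolding M_def by simp
  have "col_poly M s = r s" if "s < ?d" for s
    by (rule poly_eqI)
      (use that ru(2)[of s] in \<open>auto simp: coeff_col_poly M_def Polynomial.coeff_eq_0\<close>)
  then have "represents m G L M"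
    unfolding represents_def using M ru(1)
    by (auto intro!: ideal_cong_sym[OF ideal_congI[of _ _ _ _ _ 0]])
  then show ?thesis by blast
qed

section \<open>Determinants modulo a scalar\<close>

lemma dvd_prod_diff:
  fixes a b :: "'b \<Rightarrow> 'a::comm_ring_1"
  assumes "\<And>i. i \<in> A \<Longrightarrow> m dvd a i - b i"
  shows "m dvd prod a A - prod b A"
  using assms
proof (induction A rule: infinite_finite_induct)
  case (insert x A)
  have "prod a (insert x A) - prod b (insert x A)
      = a x * (prod a A - prod b A) + (a x - b x) * prod b A"
    using insert by (simp add: algebra_simps)
  then show ?case using insert by (metis dvd_add dvd_mult dvd_mult2 insertCI)
qed simp_all

lemma det_dvd_diff:
  fixes M N :: "'a::idom mat"
  assumes "M \<in> carrier_mat d d" "N \<in> carrier_mat d d"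
    and "\<And>r s. r < d \<Longrightarrow> s < d \<Longrightarrow> m dvd M $$ (r, s) - N $$ (r, s)"
  shows "m dvd det M - det N"
proof -
  have "m dvd signof p * (\<Prod>i = 0..<d. M $$ (i, p i)) - signof p * (\<Prod>i = 0..<d. N $$ (i, p i))"
    if "p permutes {0..<d}" for p
  proof -
    have "p i < d" if "i < d" for i
      using \<open>p permutes {0..<d}\<close> that permutes_in_image[of p "{0..<d}" i] by auto
    then have "m dvd (\<Prod>i = 0..<d. M $$ (i, p i)) - (\<Prod>i = 0..<d. N $$ (i, p i))"
      using assms(3) by (intro dvd_prod_diff) auto
    then show ?thesis by (metis dvd_mult right_diff_distrib)
  qed
  then show ?thesis
    unfolding det_def'[OF assms(1)] det_def'[OF assms(2)] sum_subtractf[symmetric]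
    by (intro dvd_sum) auto
qed

text \<open>Entries that agree modulo \<open>m\<close> give determinants that agree modulo
  \<open>m\<close>, so the determinant modulo \<open>m\<close> is an invariant of the induced
  map.\<close>

lemma represents_det_dvd:
  assumes "lead_coeff G = 1" "represents m G L M" "represents m G L' M'"
    and "\<And>s. s < Polynomial.degree G \<Longrightarrow>
           ideal_cong m G (L (Polynomial.monom 1 s)) (L' (Polynomial.monom 1 s))"
  shows "m dvd det M - det M'"
  using assms represents_unique[OF assms] unfolding represents_def
  by (intro det_dvd_diff[of _ "Polynomial.degree G"]) auto

section \<open>Multiplication and substitution maps on the quotient\<close>

lemma ideal_linear_mult: "ideal_linear m G ((*) h)"
  unfolding ideal_linear_def by (auto simp: distrib_left intro: ideal_cong_mult_left)

text \<open>Since \<open>G(q)\<close> lies in the ideal \<open>(G, m)\<close>, substituting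
  \<open>q\<close> maps that ideal into itself.\<close>

lemma ideal_linear_subst:
  fixes G :: "'a::idom poly"
  assumes "ideal_cong m G (pcompose G q) 0"
  shows "ideal_linear m G (\<lambda>p. pcompose p q)"
  unfolding ideal_linear_def
proof (intro conjI allI impI)
  fix p p' assume "ideal_cong m G p p'"
  then obtain u v where "p - p' = G * u + Polynomial.smult m v" unfolding ideal_cong_def by blast
  then have "pcompose p q - pcompose p' q = pcompose G q * pcompose u q + Polynomial.smult m (pcompose v q)"
    by (simp flip: pcompose_mult pcompose_add pcompose_smult pcompose_diff)
  moreover have "ideal_cong m G (pcompose u q * pcompose G q + Polynomial.smult m (pcompose v q)) (pcompose u q * 0 + 0)"
    using assms by (intro ideal_cong_add ideal_cong_mult_left) (auto intro: ideal_congI[of _ _ _ 0])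
  ultimately show "ideal_cong m G (pcompose p q) (pcompose p' q)"
    unfolding ideal_cong_def by (simp add: mult.commute)
qed (simp_all add: pcompose_add pcompose_smult)

lemma det_pow:
  fixes M :: "'a::idom mat"
  assumes "M \<in> carrier_mat d d"
  shows "det (M ^\<^sub>m i) = det M ^ i"
  by (induction i) (use assms in \<open>auto simp: det_mult[of _ d] pow_carrier_mat mult.commute\<close>)

lemma pcompose_monom_1:
  "pcompose (Polynomial.monom (1::'a::idom) k) q = q ^ k"
  by (induction k) (simp_all add: monom_Suc pcompose_pCons)

text \<open>Let \<open>P\<close> be the matrix of \<open>p(x) \<mapsto> p(x^n)\<close>. Its
  \<open>i\<close>-th power represents the identity, so \<open>det P\<close> is a unit modulo
  \<open>m\<close> and cancels from the relation between \<open>P * M\<close> and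
  \<open>M' * P\<close>.\<close>

lemma frobenius_det_cong:
  fixes G h :: "'a::idom poly"
  assumes monic: "lead_coeff G = 1"
    and G: "ideal_cong m G (pcompose G (Polynomial.monom 1 n)) 0"
    and i: "i > 0" "ideal_cong m G (Polynomial.monom 1 (n ^ i)) (Polynomial.monom 1 1)"
    and M: "represents m G ((*) h) M" "represents m G ((*) (pcompose h (Polynomial.monom 1 n))) M'"
  shows "m dvd det M - det M'"
proof -
  define \<sigma> where "\<sigma> = (\<lambda>p::'a poly. pcompose p (Polynomial.monom 1 n))"
  let ?d = "Polynomial.degree G"
  have lin: "ideal_linear m G \<sigma>" unfolding \<sigma>_def by (rule ideal_linear_subst[OF G])
  obtain P where P: "represents m G \<sigma> P" using represents_exists[OF monic] by blast
  have c: "P \<in> carrier_mat ?d ?d" "M \<in> carrier_mat ?d ?d" "M' \<in> carrier_mat ?d ?d"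
    using P M unfolding represents_def by auto
  have linp: "ideal_linear m G (\<sigma> ^^ j)" for j
    using lin by (induction j) (auto simp: ideal_linear_def)
  have repp: "represents m G (\<sigma> ^^ j) (P ^\<^sub>m j)" for j
  proof (induction j)
    case 0
    show ?case using c by (auto simp: represents_def col_poly_one)
  next
    case (Suc j)
    show ?case using represents_mult[OF Suc P linp] by (simp add: funpow_swap1 comp_def)
  qed
  have \<sigma>x: "(\<sigma> ^^ j) (Polynomial.monom 1 s) = Polynomial.monom 1 (n ^ j * s)" for j s
    by (induction j) (simp_all add: \<sigma>_def pcompose_monom_1 monom_power algebra_simps)
  have "m dvd det (P ^\<^sub>m i) - det (1\<^sub>m ?d)"
  proof (rule represents_det_dvd[OF monic repp[of i], where L' = id])
    show "represents m G id (1\<^sub>m ?d)" by (auto simp: represents_def col_poly_one)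
    fix s
    have "ideal_cong m G (Polynomial.monom 1 (n ^ i) ^ s) (Polynomial.monom 1 1 ^ s)"
      using i(2) by (rule ideal_cong_power)
    then show "ideal_cong m G ((\<sigma> ^^ i) (Polynomial.monom 1 s)) (id (Polynomial.monom 1 s))"
      by (simp add: \<sigma>x monom_power)
  qed
  then have inv: "m dvd det P ^ i - 1" using det_pow[OF c(1)] by simp
  \<comment> \<open>Both products represent \<open>p(x) \<mapsto> h(x^n) * p(x^n)\<close>.\<close>
  have "m dvd det (P * M) - det (M' * P)"
  proof (rule represents_det_dvd[OF monic])
    show "represents m G (\<sigma> \<circ> (*) h) (P * M)" by (rule represents_mult[OF P M(1) lin])
    show "represents m G ((*) (\<sigma> h) \<circ> \<sigma>) (M' * P)"
      using represents_mult[OF M(2) P ideal_linear_mult] unfolding \<sigma>_def .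
  qed (simp add: \<sigma>_def pcompose_mult)
  then have "m dvd det P * (det M - det M')"
    using c by (simp add: det_mult[of _ ?d] algebra_simps)
  \<comment> \<open>Further factors \<open>det P\<close> are multiplied in, which uses
    \<open>i > 0\<close>, to reach the power known to be \<open>1\<close> modulo
    \<open>m\<close>.\<close>
  then have "m dvd det P ^ i * (det M - det M')"
    using i(1) by (cases i) (simp_all add: mult.assoc mult.left_commute[of "det P"] dvd_mult)
  moreover have "m dvd (det P ^ i - 1) * (det M - det M')" using inv by simp
  moreover have "det M - det M' = det P ^ i * (det M - det M') - (det P ^ i - 1) * (det M - det M')"
    by (simp add: algebra_simps)
  ultimately show ?thesis by (metis dvd_diff)
qed


section \<open>The determinant of multiplication as a product over the roots\<close>

text \<open>Multiplication by any \<open>q\<close> is triangular in the basis of partial products of the linear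
  factors of \<open>G\<close>, with the values of \<open>q\<close> at the roots on the diagonal.\<close>

lemma newton_basis_expansion:
  fixes \<gamma> :: "nat \<Rightarrow> 'a::idom" and d :: nat
  defines "b \<equiv> \<lambda>s. \<Prod>i<s. [:- \<gamma> i, 1:]"
  assumes "s \<le> d"
  shows "\<exists>t. ideal_cong 0 (b d) (q * b s) (\<Sum>r\<in>{s..<d}. Polynomial.smult (t r) (b r)) \<and>
             (s < d \<longrightarrow> t s = poly q (\<gamma> s))"
  using assms(2)
\<comment> \<open>The induction runs downward from \<open>d\<close>, where \<open>q * b d\<close> is
  itself a multiple of \<open>b d\<close>. It covers all \<open>q\<close> at once, since the step
  passes to the quotient \<open>w\<close>.\<close>
proof (induction arbitrary: q rule: inc_induct)
  case base
  show ?case by (intro exI conjI ideal_congI[of _ _ _ q _ 0]) (simp_all add: mult.commute)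
next
  case (step s)
  \<comment> \<open>Dividing \<open>q\<close> by \<open>x - \<gamma> s\<close> leaves the remainder
    \<open>q(\<gamma> s)\<close>, which becomes the diagonal entry, while
    \<open>w * b (Suc s)\<close> contributes only later basis elements.\<close>
  define w where "w = synthetic_div q (\<gamma> s)"
  obtain t where t: "ideal_cong 0 (b d) (w * b (Suc s)) (\<Sum>r\<in>{Suc s..<d}. Polynomial.smult (t r) (b r))"
    using step.IH by blast
  have q: "q = [:- \<gamma> s, 1:] * w + [:poly q (\<gamma> s):]"
    unfolding w_def by (rule synthetic_div_correct'[symmetric])
  have "q * b s = ([:- \<gamma> s, 1:] * w + [:poly q (\<gamma> s):]) * b s" using q by simp
  also have "\<dots> = Polynomial.smult (poly q (\<gamma> s)) (b s) + w * b (Suc s)"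
    unfolding b_def prod.lessThan_Suc by (simp add: algebra_simps)
  finally have eq: "q * b s = Polynomial.smult (poly q (\<gamma> s)) (b s) + w * b (Suc s)" .
  have "ideal_cong 0 (b d) (q * b s)
    (Polynomial.smult (poly q (\<gamma> s)) (b s) + (\<Sum>r\<in>{Suc s..<d}. Polynomial.smult (t r) (b r)))"
    unfolding eq using t by (intro ideal_cong_add) auto
  also have "(\<Sum>r\<in>{Suc s..<d}. Polynomial.smult (t r) (b r))
      = (\<Sum>r\<in>{Suc s..<d}. Polynomial.smult ((t(s := poly q (\<gamma> s))) r) (b r))"
    by (intro sum.cong) auto
  also have "Polynomial.smult (poly q (\<gamma> s)) (b s) + \<dots>
      = (\<Sum>r\<in>{s..<d}. Polynomial.smult ((t(s := poly q (\<gamma> s))) r) (b r))"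
    using step.hyps by (simp add: sum.atLeast_Suc_lessThan[of s d])
  finally show ?case by (intro exI[of _ "t(s := poly q (\<gamma> s))"]) simp
qed

lemma degree_prod_linear_factors:
  fixes \<gamma> :: "'b \<Rightarrow> 'a::idom"
  assumes "finite A"
  shows "Polynomial.degree (\<Prod>i\<in>A. [:- \<gamma> i, 1:]) = card A"
  using assms by (simp add: degree_prod_eq_sum_degree)

lemma monic_prod_linear_factors:
  fixes \<gamma> :: "'b \<Rightarrow> 'a::idom"
  shows "lead_coeff (\<Prod>i\<in>A. [:- \<gamma> i, 1:]) = 1"
proof -
  have "lead_coeff (\<Prod>i\<in>A. [:- \<gamma> i, 1:]) = (\<Prod>i\<in>A. lead_coeff [:- \<gamma> i, 1:])"
    by (rule lead_coeff_prod)
  also have "\<dots> = 1" by simp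
  finally show ?thesis .
qed

lemma prod_list_diag_mat: "M \<in> carrier_mat d d \<Longrightarrow> prod_list (diag_mat M) = (\<Prod>i<d. M $$ (i, i))"
  by (auto simp: diag_mat_def prod.list_conv_set_nth atLeast0LessThan intro!: prod.cong)

text \<open>With \<open>Q\<close> the matrix of the Newton basis and \<open>T\<close> that of
  multiplication in this basis, \<open>M * Q\<close> and \<open>Q * T\<close> represent the same
  map. \<open>Q\<close> is upper triangular with unit diagonal, and \<open>T\<close> is lower
  triangular with the values of \<open>h\<close> on its diagonal.\<close>

lemma det_represents_eq_prod_roots:
  fixes \<gamma> :: "nat \<Rightarrow> 'a::idom"
  assumes G: "G = (\<Prod>i<d. [:- \<gamma> i, 1:])" and M: "represents 0 G ((*) h) M"
  shows "det M = (\<Prod>i<d. poly h (\<gamma> i))"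
proof -
  define b where "b = (\<lambda>s. \<Prod>i<s. [:- \<gamma> i, 1:])"
  have b: "Polynomial.degree (b s) = s" "lead_coeff (b s) = 1" for s
    unfolding b_def by (simp add: degree_prod_linear_factors, rule monic_prod_linear_factors)
  have bd: "b d = G" unfolding b_def G ..
  note dG = b(1)[of d, unfolded bd] and monic = b(2)[of d, unfolded bd]
  have "\<forall>s. \<exists>t. s < d \<longrightarrow> ideal_cong 0 G (h * b s) (\<Sum>r\<in>{s..<d}. Polynomial.smult (t r) (b r)) \<and>
             t s = poly h (\<gamma> s)"
  proof
    fix s
    show "\<exists>t. s < d \<longrightarrow> ideal_cong 0 G (h * b s) (\<Sum>r\<in>{s..<d}. Polynomial.smult (t r) (b r)) \<and>
             t s = poly h (\<gamma> s)"
    proof (cases "s < d")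
      case True
      then show ?thesis
        using newton_basis_expansion[of s d \<gamma> h] unfolding bd[symmetric] b_def by auto
    qed simp
  qed
  then obtain t where t: "\<And>s. s < d \<Longrightarrow> ideal_cong 0 G (h * b s) (\<Sum>r\<in>{s..<d}. Polynomial.smult (t s r) (b r))"
      "\<And>s. s < d \<Longrightarrow> t s s = poly h (\<gamma> s)" by metis
  define Q where "Q = mat d d (\<lambda>(r, s). Polynomial.coeff (b s) r)"
  define T where "T = mat d d (\<lambda>(r, s). if s \<le> r then t s r else 0)"
  \<comment> \<open>Only the values at the monomials \<open>x^s\<close> matter, and there the degree
    recovers \<open>s\<close>. \<open>L\<close> will be the inner map in
    \<open>represents_mult\<close>, whose linearity condition concerns the outer one.\<close>
  define L where "L = (\<lambda>p::'a poly. b (Polynomial.degree p))"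
  have L: "L (Polynomial.monom 1 s) = b s" for s unfolding L_def by (simp add: Polynomial.degree_monom_eq)
  have c: "Q \<in> carrier_mat d d" "T \<in> carrier_mat d d" "M \<in> carrier_mat d d"
    using M dG unfolding represents_def Q_def T_def by auto
  have colQ: "col_poly Q s = b s" if "s < d" for s
    by (rule poly_eqI) (use that b in \<open>auto simp: coeff_col_poly Q_def Polynomial.coeff_eq_0\<close>)
  have "represents 0 G L Q"
    unfolding represents_def using c by (auto simp: dG L colQ)
  then have MQ: "represents 0 G ((*) h \<circ> L) (M * Q)"
    using represents_mult[OF M _ ideal_linear_mult] by blast
  have QT: "represents 0 G ((*) h \<circ> L) (Q * T)"
    unfolding represents_def dG
  proof (intro conjI allI impI)
    fix s assume s: "s < d"
    have "col_poly (Q * T) s = (\<Sum>r<d. Polynomial.smult (T $$ (r, s)) (b r))"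
      using col_poly_mult[OF c(1,2) s] colQ by simp
    also have "\<dots> = (\<Sum>r\<in>{s..<d}. Polynomial.smult (t s r) (b r))"
      by (rule sum.mono_neutral_cong_right) (use s in \<open>auto simp: T_def\<close>)
    finally show "ideal_cong 0 G (col_poly (Q * T) s) (((*) h \<circ> L) (Polynomial.monom 1 s))"
      using ideal_cong_sym[OF t(1)[OF s]] by (simp add: L)
  qed (use c in auto)
  have "det (M * Q) = det (Q * T)"
    using represents_det_dvd[OF monic MQ QT] by simp
  moreover have "det Q = 1"
  proof -
    have "upper_triangular Q" using c b by (auto simp: Q_def Polynomial.coeff_eq_0)
    then have "det Q = (\<Prod>i<d. Q $$ (i, i))"
      using det_upper_triangular[OF _ c(1)] prod_list_diag_mat[OF c(1)] by simp
    also have "\<dots> = 1"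
    proof (intro prod.neutral ballI)
      fix i assume "i \<in> {..<d}"
      then show "Q $$ (i, i) = 1" using b(2)[of i] unfolding b(1) by (simp add: Q_def)
    qed
    finally show ?thesis .
  qed
  moreover have "det T = (\<Prod>i<d. poly h (\<gamma> i))"
  proof -
    have "det T = prod_list (diag_mat T)"
      by (rule det_lower_triangular[of d]) (use c in \<open>auto simp: T_def\<close>)
    also have "\<dots> = (\<Prod>i<d. poly h (\<gamma> i))"
      unfolding prod_list_diag_mat[OF c(2)] by (rule prod.cong) (simp_all add: T_def t)
    finally show ?thesis .
  qed
  ultimately show ?thesis using c by (simp add: det_mult[of _ d])
qed


section \<open>The determinant of multiplication\<close>

lemma (in idom_hom) ideal_cong_map:
  assumes "ideal_cong m G p q"
  shows "ideal_cong (hom m) (map_poly hom G) (map_poly hom p) (map_poly hom q)"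
proof -
  interpret mp: map_poly_idom_hom hom ..
  obtain u v where "p - q = G * u + Polynomial.smult m v" using assms unfolding ideal_cong_def by blast
  then have "map_poly hom (p - q) = map_poly hom (G * u + Polynomial.smult m v)" by simp
  then show ?thesis by (intro ideal_congI) (simp add: hom_distribs)
qed

lemma (in idom_hom) monic_map_poly:
  assumes "lead_coeff G = 1"
  shows "Polynomial.degree (map_poly hom G) = Polynomial.degree G" "lead_coeff (map_poly hom G) = 1"
proof -
  have "Polynomial.coeff (map_poly hom G) (Polynomial.degree G) = 1"
    using assms by (simp add: coeff_map_poly)
  moreover from this show "Polynomial.degree (map_poly hom G) = Polynomial.degree G"
    by (intro antisym degree_map_poly_le Polynomial.le_degree) simp
  ultimately show "lead_coeff (map_poly hom G) = 1" by simp
qed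

lemma represents_weaken: "represents 0 G L M \<Longrightarrow> represents m G L M"
  unfolding represents_def ideal_cong_def by (metis smult_0_left smult_0_right)

lemma (in idom_hom) represents_map:
  assumes "lead_coeff G = 1" "represents m G ((*) h) M"
  shows "represents (hom m) (map_poly hom G) ((*) (map_poly hom h)) (map_mat hom M)"
proof -
  interpret mp: map_poly_idom_hom hom ..
  have d: "Polynomial.degree (map_poly hom G) = Polynomial.degree G"
    by (rule monic_map_poly(1)[OF assms(1)])
  have M: "M \<in> carrier_mat (Polynomial.degree G) (Polynomial.degree G)"
    using assms(2) unfolding represents_def by simp
  have "col_poly (map_mat hom M) s = map_poly hom (col_poly M s)" if "s < Polynomial.degree G" for s
    by (rule poly_eqI) (use M that in \<open>auto simp: coeff_col_poly coeff_map_poly\<close>)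
  moreover have "map_poly hom (h * Polynomial.monom 1 s) = map_poly hom h * Polynomial.monom 1 s" for s
    by (simp add: mp.hom_mult map_poly_monom)
  ultimately show ?thesis
    using assms(2) ideal_cong_map[of m G "col_poly M _" "h * Polynomial.monom 1 _"]
    unfolding represents_def d by auto
qed

text \<open>This is the norm \<open>N G h\<close> of the overview. For monic \<open>G\<close> a
  representing matrix exists and its determinant does not depend on the choice.\<close>

definition mult_det :: "'a::idom poly \<Rightarrow> 'a poly \<Rightarrow> 'a" where
  "mult_det G h = det (SOME M. represents 0 G ((*) h) M)"

text \<open>Modulo \<open>m\<close> the norm can be read off any matrix that represents
  multiplication modulo \<open>(G, m)\<close>, not only modulo \<open>G\<close>.\<close>

lemma mult_det_cong:
  assumes "lead_coeff G = 1" "represents m G ((*) h) M"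
  shows "m dvd det M - mult_det G h"
proof -
  have "represents 0 G ((*) h) (SOME M. represents 0 G ((*) h) M)"
    using represents_exists[OF assms(1)] by (rule someI_ex)
  then have "represents m G ((*) h) (SOME M. represents 0 G ((*) h) M)"
    by (rule represents_weaken)
  then show ?thesis
    unfolding mult_det_def using assms by (intro represents_det_dvd[OF assms(1)]) auto
qed

lemma mult_det_eq:
  assumes "lead_coeff G = 1" "represents 0 G ((*) h) M"
  shows "mult_det G h = det M"
  using mult_det_cong[OF assms] by simp

lemma mult_det_eq_prod_roots:
  fixes A :: "'a::idom multiset"
  assumes "G = (\<Prod>x\<in>#A. [:- x, 1:])"
  shows "mult_det G h = (\<Prod>x\<in>#A. poly h x)"
proof -
  obtain xs where xs: "A = mset xs" by (metis ex_mset)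
  have conv: "(\<Prod>x\<in>#A. c x) = (\<Prod>i<length xs. c (xs ! i))" for c :: "'a \<Rightarrow> 'b::comm_monoid_mult"
  proof -
    have "(\<Prod>x\<in>#A. c x) = prod_list (map c xs)"
      unfolding xs by (metis mset_map prod_mset_prod_list)
    then show ?thesis by (simp add: prod.list_conv_set_nth atLeast0LessThan)
  qed
  have G: "G = (\<Prod>i<length xs. [:- (xs ! i), 1:])" using assms by (simp add: conv)
  have monic: "lead_coeff G = 1" unfolding G by (rule monic_prod_linear_factors)
  obtain M where M: "represents 0 G ((*) h) M" using represents_exists[OF monic] by blast
  show ?thesis
    using mult_det_eq[OF monic M] det_represents_eq_prod_roots[OF G M] by (simp add: conv)
qed

lemma (in idom_hom) hom_mult_det:
  assumes "lead_coeff G = 1"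
  shows "hom (mult_det G h) = mult_det (map_poly hom G) (map_poly hom h)"
proof -
  obtain M where M: "represents 0 G ((*) h) M" using represents_exists[OF assms] by blast
  have "represents 0 (map_poly hom G) ((*) (map_poly hom h)) (map_mat hom M)"
    using represents_map[OF assms M] by simp
  from mult_det_eq[OF monic_map_poly(2)[OF assms] this] show ?thesis
    by (simp add: mult_det_eq[OF assms M])
qed

lemma const_poly_hom: "idom_hom (\<lambda>c::'a::idom. [:c:])"
  by unfold_locales (auto simp: one_pCons)

text \<open>The norm commutes with the base change from \<open>\<int>[t]\<close> to
  \<open>\<complex>[t]\<close>. There \<open>G\<close>, whose coefficients are constants in
  \<open>t\<close>, splits, and its roots are the constant polynomials \<open>[:x:]\<close>.\<close>

lemma complex_mult_det_prod_roots:
  fixes G :: "int poly" and h :: "int poly poly" and A :: "complex multiset"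
  assumes "lead_coeff G = 1" "of_int_poly G = (\<Prod>x\<in>#A. [:- x, 1:])"
  shows "of_int_poly (mult_det (of_int_poly G) h) = (\<Prod>x\<in>#A. poly (map_poly of_int_poly h) [:x:])"
proof -
  interpret C: idom_hom "\<lambda>c::complex. [:c:]" by (rule const_poly_hom)
  interpret CP: map_poly_idom_hom "\<lambda>c::complex. [:c:]" ..
  have const: "of_int_poly (of_int c :: int poly) = [:of_int c :: complex:]" for c
    by (rule trans[OF of_int_poly_hom.hom_of_int of_int_poly])
  have "map_poly of_int_poly (of_int_poly G :: int poly poly)
      = map_poly (\<lambda>c::complex. [:c:]) (of_int_poly G)"
    by (rule poly_eqI) (simp add: coeff_map_poly const)
  also have "\<dots> = (\<Prod>x\<in>#A. map_poly (\<lambda>c. [:c:]) [:- x, 1:])"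
    unfolding assms(2) CP.hom_prod_mset image_mset.compositionality comp_def ..
  also have "\<dots> = (\<Prod>x\<in>#image_mset (\<lambda>c. [:c:]) A. [:- x, 1:])"
    by (simp add: image_mset.compositionality comp_def map_poly_pCons pCons_one)
  finally have "mult_det (map_poly of_int_poly (of_int_poly G :: int poly poly)) (map_poly of_int_poly h)
      = (\<Prod>x\<in>#image_mset (\<lambda>c. [:c:]) A. poly (map_poly of_int_poly h) x)"
    by (rule mult_det_eq_prod_roots)
  also have "\<dots> = (\<Prod>x\<in>#A. poly (map_poly of_int_poly h) [:x:])"
    by (simp add: image_mset.compositionality comp_def)
  finally have "mult_det (map_poly of_int_poly (of_int_poly G :: int poly poly)) (map_poly of_int_poly h)
      = (\<Prod>x\<in>#A. poly (map_poly of_int_poly h) [:x:])" .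
  moreover have "(of_int_poly (mult_det (of_int_poly G) h) :: complex poly)
      = mult_det (map_poly of_int_poly (of_int_poly G)) (map_poly of_int_poly h)"
    by (rule of_int_poly_hom.hom_mult_det) (simp add: assms(1))
  ultimately show ?thesis by simp
qed

lemma complex_roots_mset:
  fixes G :: "int poly"
  assumes "lead_coeff G = 1"
  shows "\<exists>A. of_int_poly G = (\<Prod>x\<in>#A. [:- x, 1 :: complex:])"
proof -
  have "lead_coeff (of_int_poly G :: complex poly) = 1" using assms by simp
  moreover have "of_int_poly G \<noteq> (0 :: complex poly)" using assms by auto
  ultimately show ?thesis
    using alg_closed_imp_factorization[of "of_int_poly G :: complex poly"] by (metis smult_1_left)
qed

text \<open>The root multiset of a product is the sum of the root multisets; the resulting identity
  in \<open>\<complex>[t]\<close> descends because \<open>\<int>[t]\<close> embeds in it.\<close>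

lemma mult_det_mult:
  fixes G H :: "int poly" and h :: "int poly poly"
  assumes "lead_coeff G = 1" "lead_coeff H = 1"
  shows "mult_det (of_int_poly (G * H)) h = mult_det (of_int_poly G) h * mult_det (of_int_poly H) h"
proof -
  obtain A B where AB: "of_int_poly G = (\<Prod>x\<in>#A. [:- x, 1 :: complex:])"
      "of_int_poly H = (\<Prod>x\<in>#B. [:- x, 1 :: complex:])"
    using complex_roots_mset assms by metis
  have "of_int_poly (G * H) = (\<Prod>x\<in>#A + B. [:- x, 1 :: complex:])"
    by (simp add: AB of_int_poly_hom.hom_mult)
  moreover have "lead_coeff (G * H) = 1" using assms by (simp add: lead_coeff_mult)
  ultimately have "of_int_poly (mult_det (of_int_poly (G * H)) h)
      = (\<Prod>x\<in>#A + B. poly (map_poly of_int_poly h) [:x:])"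
    by (intro complex_mult_det_prod_roots)
  also have "\<dots> = (of_int_poly (mult_det (of_int_poly G) h * mult_det (of_int_poly H) h) :: complex poly)"
    using complex_mult_det_prod_roots[OF assms(1) AB(1)] complex_mult_det_prod_roots[OF assms(2) AB(2)]
    by (simp add: of_int_poly_hom.hom_mult)
  finally have "of_int_poly (mult_det (of_int_poly (G * H)) h)
      = (of_int_poly (mult_det (of_int_poly G) h * mult_det (of_int_poly H) h) :: complex poly)" .
  then show ?thesis by (rule of_int_poly_hom.injectivity)
qed

lemma mult_det_prod:
  fixes G :: "'b \<Rightarrow> int poly" and h :: "int poly poly"
  assumes "finite I" "\<And>i. i \<in> I \<Longrightarrow> lead_coeff (G i) = 1"
  shows "mult_det (of_int_poly (\<Prod>i\<in>I. G i)) h = (\<Prod>i\<in>I. mult_det (of_int_poly (G i)) h)"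
  using assms
proof (induction I rule: finite_induct)
  case empty
  show ?case using mult_det_eq_prod_roots[of 1 "{#}" h] by simp
next
  case (insert i I)
  have "lead_coeff (\<Prod>i\<in>I. G i) = (\<Prod>i\<in>I. lead_coeff (G i))" by (rule lead_coeff_prod)
  then have "lead_coeff (\<Prod>i\<in>I. G i) = 1" using insert by simp
  then show ?case using insert by (simp add: mult_det_mult)
qed

text \<open>If \<open>g\<close> had smaller degree, \<open>n\<close> would divide the leading
  coefficient \<open>1\<close> of \<open>f\<close>.\<close>

lemma monic_cong_degree_le:
  fixes f g k :: "int poly" and n :: nat
  assumes "n > 1" "lead_coeff f = 1" "f - g = Polynomial.smult (int n) k"
  shows "Polynomial.degree f \<le> Polynomial.degree g"
proof (rule ccontr)
  assume "\<not> ?thesis"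
  then have "Polynomial.coeff (f - g) (Polynomial.degree f) = 1"
    using assms(2) by (simp add: Polynomial.coeff_eq_0)
  then have "int n dvd 1" unfolding assms(3) by (metis coeff_smult dvd_triv_left)
  then show False using assms(1) by simp
qed

text \<open>Multiples of \<open>f\<close> lie in the ideal \<open>(g, n)\<close> and the degrees
  agree, so a matrix of multiplication modulo \<open>f\<close> also represents it modulo
  \<open>(g, n)\<close>.\<close>

lemma mult_det_poly_cong:
  fixes f g k :: "int poly" and n :: nat and h :: "int poly poly"
  assumes "n > 1" "lead_coeff f = 1" "lead_coeff g = 1" "f - g = Polynomial.smult (int n) k"
  shows "of_nat n dvd mult_det (of_int_poly f) h - mult_det (of_int_poly g) h"
proof -
  let ?f = "of_int_poly f :: int poly poly" and ?g = "of_int_poly g :: int poly poly"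
  have "g - f = Polynomial.smult (int n) (- k)"
    using arg_cong[OF assms(4), of uminus] by simp
  then have deg: "Polynomial.degree f = Polynomial.degree g"
    using monic_cong_degree_le assms by (metis antisym)
  have "?f - ?g = of_int_poly (f - g)" by (simp add: hom_distribs)
  then have fg: "?f = ?g + Polynomial.smult (of_nat n) (of_int_poly k)"
    unfolding assms(4) by (simp add: hom_distribs algebra_simps)
  have monic: "lead_coeff ?f = 1" "lead_coeff ?g = 1" using assms by simp_all
  obtain M where M: "represents 0 ?f ((*) h) M" using represents_exists[OF monic(1)] by blast
  have "ideal_cong (of_nat n) ?g p q" if "ideal_cong 0 ?f p q" for p q
  proof -
    from that obtain u where "p - q = ?f * u" unfolding ideal_cong_def by auto
    then show ?thesis
      unfolding fg by (intro ideal_congI[of _ _ _ u _ "of_int_poly k * u"]) (simp add: algebra_simps)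
  qed
  then have "represents (of_nat n) ?g ((*) h) M"
    using M deg unfolding represents_def by simp
  then show ?thesis using mult_det_cong[OF monic(2)] mult_det_eq[OF monic(1) M] by simp
qed

text \<open>Modulo \<open>n\<close> the polynomial \<open>f\<close> may be replaced by the product
  of the \<open>G i\<close>. The norm splits over the factors, and each one is handled by
  \<open>frobenius_det_cong\<close> with coefficients extended from \<open>\<int>\<close> to
  \<open>\<int>[t]\<close>.\<close>

lemma mult_det_frobenius_cong:
  fixes f :: "int poly" and n :: nat and h :: "int poly poly" and G :: "'b \<Rightarrow> int poly"
  assumes n: "n > 1" and f: "lead_coeff f = 1" and I: "finite I"
    and k: "f - (\<Prod>i\<in>I. G i) = Polynomial.smult (int n) k"
    and G: "\<And>i. i \<in> I \<Longrightarrow> lead_coeff (G i) = 1"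
      "\<And>i. i \<in> I \<Longrightarrow> ideal_cong (int n) (G i) (pcompose (G i) (Polynomial.monom 1 n)) 0"
      "\<And>i. i \<in> I \<Longrightarrow>
         \<exists>e>0. ideal_cong (int n) (G i) (Polynomial.monom 1 (n ^ e)) (Polynomial.monom 1 1)"
  shows "of_nat n dvd mult_det (of_int_poly f) h -
           mult_det (of_int_poly f) (pcompose h (Polynomial.monom 1 n))"
proof -
  let ?h = "pcompose h (Polynomial.monom 1 n)" and ?g = "\<Prod>i\<in>I. G i"
  have "of_nat n dvd mult_det (of_int_poly (G i)) h - mult_det (of_int_poly (G i)) ?h" if i: "i \<in> I" for i
  proof -
    let ?G = "of_int_poly (G i) :: int poly poly"
    have monic: "lead_coeff ?G = 1" using G(1)[OF i] by simp
    obtain e where e: "e > 0" "ideal_cong (int n) (G i) (Polynomial.monom 1 (n ^ e)) (Polynomial.monom 1 1)"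
      using G(3)[OF i] by blast
    obtain M M' where M: "represents 0 ?G ((*) h) M" "represents 0 ?G ((*) ?h) M'"
      using represents_exists[OF monic] by metis
    note M' = represents_weaken[OF M(1), of "of_nat n"] represents_weaken[OF M(2), of "of_nat n"]
    have 1: "ideal_cong (of_nat n) ?G (Polynomial.monom 1 (n ^ e)) (Polynomial.monom 1 1)"
      using of_int_hom.ideal_cong_map[OF e(2)] by (simp add: map_poly_monom)
    have 2: "ideal_cong (of_nat n) ?G (pcompose ?G (Polynomial.monom 1 n)) 0"
      using of_int_hom.ideal_cong_map[OF G(2)[OF i]] by (simp add: map_poly_monom of_int_hom.map_poly_pcompose)
    show ?thesis
      using frobenius_det_cong[OF monic 2 e(1) 1 M'] by (simp add: mult_det_eq[OF monic M(1)] mult_det_eq[OF monic M(2)])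
  qed
  then have "of_nat n dvd (\<Prod>i\<in>I. mult_det (of_int_poly (G i)) h) - (\<Prod>i\<in>I. mult_det (of_int_poly (G i)) ?h)"
    by (rule dvd_prod_diff)
  then have 1: "of_nat n dvd mult_det (of_int_poly ?g) h - mult_det (of_int_poly ?g) ?h"
    using mult_det_prod[OF I G(1)] by simp
  have "lead_coeff ?g = (\<Prod>i\<in>I. lead_coeff (G i))" by (rule lead_coeff_prod)
  then have "lead_coeff ?g = 1" using G(1) by simp
  then have 2: "of_nat n dvd mult_det (of_int_poly f) h - mult_det (of_int_poly ?g) h"
    for h :: "int poly poly" by (rule mult_det_poly_cong[OF n f _ k])
  show ?thesis
    using dvd_diff[OF dvd_add[OF 2[of h] 1] 2[of ?h]] by simp
qed


section \<open>Symmetric polynomials\<close>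

text \<open>The residue modulo \<open>B\<close> recovers the lowest digit; cancelling it and
  dividing by \<open>B\<close> leaves a shorter digit sum.\<close>

lemma digit_sum_inj:
  fixes a b :: "nat \<Rightarrow> nat"
  assumes "\<And>j. j \<le> N \<Longrightarrow> a j < B" "\<And>j. j \<le> N \<Longrightarrow> b j < B"
    and "(\<Sum>j\<le>N. a j * B ^ j) = (\<Sum>j\<le>N. b j * B ^ j)" "j \<le> N"
  shows "a j = b j"
  using assms
proof (induction N arbitrary: a b j)
  case (Suc N)
  have split: "(\<Sum>j\<le>Suc N. c j * B ^ j) = c 0 + (\<Sum>j\<le>N. c (Suc j) * B ^ j) * B" for c :: "nat \<Rightarrow> nat"
    by (subst sum.atMost_Suc_shift) (simp add: sum_distrib_left ac_simps)
  have lt: "a 0 < B" "b 0 < B" using Suc.prems by auto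
  have eq: "a 0 + (\<Sum>j\<le>N. a (Suc j) * B ^ j) * B = b 0 + (\<Sum>j\<le>N. b (Suc j) * B ^ j) * B"
    using Suc.prems(3) unfolding split .
  from arg_cong[OF eq, of "\<lambda>x. x mod B"] have 0: "a 0 = b 0" using lt by simp
  then have IH: "(\<Sum>j\<le>N. a (Suc j) * B ^ j) = (\<Sum>j\<le>N. b (Suc j) * B ^ j)" using eq lt by simp
  have "\<forall>j\<le>N. a (Suc j) = b (Suc j)"
    by (intro allI impI Suc.IH[OF _ _ IH]) (simp_all add: Suc.prems)
  then show ?case using 0 Suc.prems(4) by (cases j) auto
qed simp

text \<open>The weight \<open>\<Sum>i. B ^ \<phi> i\<close> has as its base \<open>B\<close> digits the multiplicities of the exponents
  \<open>\<phi> i\<close>, so it determines the exponent vector up to permutation.\<close>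

lemma weight_eq_imp_permutes:
  fixes \<phi> \<psi> :: "'a \<Rightarrow> nat"
  assumes "finite A" "card A < B" "\<And>i. i \<in> A \<Longrightarrow> \<phi> i \<le> N" "\<And>i. i \<in> A \<Longrightarrow> \<psi> i \<le> N"
    and "(\<Sum>i\<in>A. B ^ \<phi> i) = (\<Sum>i\<in>A. B ^ \<psi> i)"
  shows "\<exists>\<pi>. \<pi> permutes A \<and> (\<forall>i\<in>A. \<phi> i = \<psi> (\<pi> i))"
proof -
  have digits: "(\<Sum>i\<in>A. B ^ \<chi> i) = (\<Sum>j\<le>N. card {i \<in> A. \<chi> i = j} * B ^ j)"
    if "\<And>i. i \<in> A \<Longrightarrow> \<chi> i \<le> N" for \<chi> :: "'a \<Rightarrow> nat"
  proof -
    have "(\<Sum>i\<in>A. B ^ \<chi> i) = (\<Sum>j\<le>N. \<Sum>i\<in>{i \<in> A. \<chi> i = j}. B ^ \<chi> i)"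
      using assms(1) that by (subst sum.group) auto
    also have "\<dots> = (\<Sum>j\<le>N. card {i \<in> A. \<chi> i = j} * B ^ j)" by simp
    finally show ?thesis .
  qed
  \<comment> \<open>Each multiplicity is at most \<open>card A\<close>, so it is a genuine base
    \<open>B\<close> digit and no carries occur.\<close>
  have small: "card {i \<in> A. \<chi> i = j} < B" for \<chi> :: "'a \<Rightarrow> nat" and j
    using assms(1,2) card_mono[of A "{i \<in> A. \<chi> i = j}"] by force
  have "card {i \<in> A. \<phi> i = j} = card {i \<in> A. \<psi> i = j}" for j
  proof (cases "j \<le> N")
    case True
    have "(\<Sum>j\<le>N. card {i \<in> A. \<phi> i = j} * B ^ j) = (\<Sum>j\<le>N. card {i \<in> A. \<psi> i = j} * B ^ j)"
      using assms(5) by (subst (1 2) digits[symmetric]) (use assms(3,4) in auto)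
    from digit_sum_inj[OF small small this True] show ?thesis .
  next
    case False
    then have "{i \<in> A. \<phi> i = j} = {}" "{i \<in> A. \<psi> i = j} = {}" using assms(3,4) by auto
    then show ?thesis by (simp only:)
  qed
  then have "image_mset \<phi> (mset_set A) = image_mset \<psi> (mset_set A)"
    using assms(1) by (intro multiset_eqI) (simp add: count_image_mset_eq_card_vimage)
  from image_mset_eq_implies_permutes[OF assms(1) this] show ?thesis by metis
qed

section \<open>Expansions over exponent vectors\<close>

definition exponent_mapping :: "nat set \<Rightarrow> (nat \<Rightarrow> nat) \<Rightarrow> nat \<Rightarrow>\<^sub>0 nat" where
  "exponent_mapping A \<phi> = Poly_Mapping.Abs_poly_mapping (\<lambda>i. if i \<in> A then \<phi> i else 0)"

lemma lookup_exponent_mapping: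
  "finite A \<Longrightarrow> Poly_Mapping.lookup (exponent_mapping A \<phi>) i = (if i \<in> A then \<phi> i else 0)"
proof -
  assume "finite A"
  then have "finite {i. (if i \<in> A then \<phi> i else 0) \<noteq> 0}" by (rule rev_finite_subset) auto
  then show ?thesis unfolding exponent_mapping_def by simp
qed

text \<open>\<open>map_key\<close> is composition only for an injective map. For the outer use this
  means injectivity on monomials, which follows from surjectivity of \<open>\<pi>\<close>.\<close>

lemma lookup_permute_vars:
  assumes "bij \<pi>"
  shows "Poly_Mapping.lookup (permute_vars \<pi> S) m = Poly_Mapping.lookup S (Poly_Mapping.map_key \<pi> m)"
proof -
  have "inj (Poly_Mapping.map_key \<pi> :: (nat \<Rightarrow>\<^sub>0 nat) \<Rightarrow> _)"
  proof (rule injI, rule poly_mapping_eqI)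
    fix p q :: "nat \<Rightarrow>\<^sub>0 nat" and i
    assume "Poly_Mapping.map_key \<pi> p = Poly_Mapping.map_key \<pi> q"
    then have "Poly_Mapping.lookup p (\<pi> j) = Poly_Mapping.lookup q (\<pi> j)" for j
      using map_key.rep_eq[OF bij_is_inj[OF assms]] by (metis comp_apply)
    moreover obtain j where "i = \<pi> j" using bij_is_surj[OF assms] by blast
    ultimately show "Poly_Mapping.lookup p i = Poly_Mapping.lookup q i" by simp
  qed
  then show ?thesis unfolding permute_vars_def by (simp add: map_key.rep_eq)
qed

text \<open>The sum over the support is spread over a full box of exponent vectors, the added terms
  being zero, to match the index set that arises from multiplying out a product.\<close>

lemma mpoly_eval_exponents:
  assumes "mpoly_vars S \<subseteq> A" "finite A"
    and N: "\<And>m i. m \<in> Poly_Mapping.keys S \<Longrightarrow> Poly_Mapping.lookup m i \<le> N"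
  shows "mpoly_eval x S =
    (\<Sum>\<phi>\<in>A \<rightarrow>\<^sub>E {..N}. of_int (Poly_Mapping.lookup S (exponent_mapping A \<phi>)) * (\<Prod>i\<in>A. x i ^ \<phi> i))"
proof -
  let ?e = "exponent_mapping A"
  let ?r = "\<lambda>m. restrict (Poly_Mapping.lookup m) A"
  have sub: "Poly_Mapping.keys m \<subseteq> A" if "m \<in> Poly_Mapping.keys S" for m
    using assms(1) that unfolding mpoly_vars_def by blast
  have er: "?e (?r m) = m" if "m \<in> Poly_Mapping.keys S" for m
  proof (rule poly_mapping_eqI)
    fix i
    show "Poly_Mapping.lookup (?e (?r m)) i = Poly_Mapping.lookup m i"
      using sub[OF that] in_keys_iff[of i m] by (cases "i \<in> A") (auto simp: lookup_exponent_mapping[OF assms(2)])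
  qed
  have "mpoly_eval x S = (\<Sum>m\<in>Poly_Mapping.keys S. of_int (Poly_Mapping.lookup S m) *
      (\<Prod>i\<in>A. x i ^ Poly_Mapping.lookup m i))"
    unfolding mpoly_eval_def
  proof (intro sum.cong refl arg_cong2[of _ _ _ _ "(*)"])
    fix m assume "m \<in> Poly_Mapping.keys S"
    then show "(\<Prod>i\<in>Poly_Mapping.keys m. x i ^ Poly_Mapping.lookup m i)
        = (\<Prod>i\<in>A. x i ^ Poly_Mapping.lookup m i)"
      using sub assms(2) by (intro prod.mono_neutral_left) (auto simp: in_keys_iff)
  qed
  also have "\<dots> = (\<Sum>\<phi>\<in>?r ` Poly_Mapping.keys S.
      of_int (Poly_Mapping.lookup S (?e \<phi>)) * (\<Prod>i\<in>A. x i ^ \<phi> i))"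
  proof -
    have "inj_on ?r (Poly_Mapping.keys S)" by (rule inj_on_inverseI[of _ ?e]) (rule er)
    then show ?thesis unfolding sum.reindex[OF \<open>inj_on ?r _\<close>] comp_def
      by (intro sum.cong refl arg_cong2[of _ _ _ _ "(*)"] prod.cong) (simp_all add: er)
  qed
  also have "\<dots> = (\<Sum>\<phi>\<in>A \<rightarrow>\<^sub>E {..N}.
      of_int (Poly_Mapping.lookup S (?e \<phi>)) * (\<Prod>i\<in>A. x i ^ \<phi> i))"
  proof (rule sum.mono_neutral_left)
    show "?r ` Poly_Mapping.keys S \<subseteq> A \<rightarrow>\<^sub>E {..N}" using N by auto
    show "\<forall>\<phi>\<in>(A \<rightarrow>\<^sub>E {..N}) - ?r ` Poly_Mapping.keys S.
        of_int (Poly_Mapping.lookup S (?e \<phi>)) * (\<Prod>i\<in>A. x i ^ \<phi> i) = 0"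
    proof
      fix \<phi> assume \<phi>: "\<phi> \<in> (A \<rightarrow>\<^sub>E {..N}) - ?r ` Poly_Mapping.keys S"
      \<comment> \<open>Outside \<open>A\<close> both sides are \<open>undefined\<close>: the left
        by membership in the extensional function space, the right by
        \<open>restrict\<close>.\<close>
      have "\<phi> = ?r (?e \<phi>)"
      proof
        fix i
        show "\<phi> i = ?r (?e \<phi>) i"
          using \<phi> PiE_arb[of \<phi> A "\<lambda>_. {..N}" i]
          by (cases "i \<in> A") (simp_all add: lookup_exponent_mapping[OF assms(2)])
      qed
      then have "?e \<phi> \<notin> Poly_Mapping.keys S" using \<phi> by blast
      then show "of_int (Poly_Mapping.lookup S (?e \<phi>)) * (\<Prod>i\<in>A. x i ^ \<phi> i) = 0"
        by (simp add: in_keys_iff)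
    qed
  qed (use assms(2) in \<open>simp add: finite_PiE\<close>)
  finally show ?thesis .
qed

text \<open>The power \<open>x ^ j\<close> is tagged with the degree \<open>B ^ j\<close> of a new
  indeterminate; in a product over several \<open>x\<close> the tags add up to the weight of the
  exponent vector.\<close>

definition weight_poly :: "nat \<Rightarrow> nat \<Rightarrow> 'a::comm_ring_1 \<Rightarrow> 'a poly" where
  "weight_poly N B x = (\<Sum>j\<le>N. Polynomial.monom (x ^ j) (B ^ j))"

lemma prod_weight_poly:
  fixes x :: "'b \<Rightarrow> 'a::comm_ring_1"
  assumes "finite A"
  shows "(\<Prod>i\<in>A. weight_poly N B (x i)) =
    (\<Sum>\<phi>\<in>A \<rightarrow>\<^sub>E {..N}. Polynomial.monom (\<Prod>i\<in>A. x i ^ \<phi> i) (\<Sum>i\<in>A. B ^ \<phi> i))"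
proof -
  have monom: "(\<Prod>i\<in>A. Polynomial.monom (c i) (e i)) = Polynomial.monom (\<Prod>i\<in>A. c i) (\<Sum>i\<in>A. e i)"
    for c :: "'b \<Rightarrow> 'a" and e
    using assms by (induction A) (simp_all add: mult_monom monom_0 pCons_one)
  show ?thesis
    unfolding weight_poly_def using assms by (subst prod_sum_PiE) (simp_all add: monom)
qed

text \<open>This replaces the fundamental theorem on symmetric polynomials: a symmetric polynomial is an
  integral combination of coefficients of a product over the variables, and these coefficients
  will be recognised as those of a determinant.\<close>

lemma symmetric_mpoly_eval:
  assumes "symmetric_mpoly k S"
  shows "\<exists>N B W c. finite (W :: nat set) \<and>
    (\<forall>x. mpoly_eval x S =
       (\<Sum>w\<in>W. of_int (c w) * Polynomial.coeff (\<Prod>i\<in>{1..k}. weight_poly N B (x i)) w))"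
proof -
  define A where "A = {1..k}"
  have A: "finite A" unfolding A_def by simp
  have vars: "mpoly_vars S \<subseteq> A" using assms unfolding symmetric_mpoly_def A_def by blast
  \<comment> \<open>A common bound for all exponents in \<open>S\<close>; the inserted
    \<open>0\<close> covers an empty set of exponents.\<close>
  define N where "N = Max (insert 0 (\<Union>m\<in>Poly_Mapping.keys S. Poly_Mapping.lookup m ` A))"
  have N: "Poly_Mapping.lookup m i \<le> N" if m: "m \<in> Poly_Mapping.keys S" for m i
  proof (cases "i \<in> A")
    case True
    then show ?thesis unfolding N_def using A m by (intro Max_ge) auto
  next
    case False
    then have "i \<notin> Poly_Mapping.keys m" using vars m unfolding mpoly_vars_def by blast
    then show ?thesis by (simp add: in_keys_iff)
  qed
  \<comment> \<open>Larger than the number of variables, so that equal weights mean equal exponent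
    vectors up to permutation.\<close>
  define B where "B = k + 1"
  define wt where "wt = (\<lambda>\<phi>::nat \<Rightarrow> nat. \<Sum>i\<in>A. B ^ \<phi> i)"
  define E where "E = (A \<rightarrow>\<^sub>E {..N})"
  have E: "finite E" unfolding E_def using A by (simp add: finite_PiE)
  define s where "s = (\<lambda>\<phi>. Poly_Mapping.lookup S (exponent_mapping A \<phi>))"
  \<comment> \<open>Symmetry of \<open>S\<close> makes its coefficients constant on the vectors of a
    given weight.\<close>
  have s: "s \<phi> = s \<psi>" if "\<phi> \<in> E" "\<psi> \<in> E" "wt \<phi> = wt \<psi>" for \<phi> \<psi>
  proof -
    have "\<exists>\<pi>. \<pi> permutes A \<and> (\<forall>i\<in>A. \<phi> i = \<psi> (\<pi> i))"
    proof (rule weight_eq_imp_permutes[OF A])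
      show "card A < B" unfolding A_def B_def by simp
      show "(\<Sum>i\<in>A. B ^ \<phi> i) = (\<Sum>i\<in>A. B ^ \<psi> i)" using that(3) unfolding wt_def .
    qed (use that in \<open>auto simp: E_def PiE_iff\<close>)
    then obtain \<pi> where \<pi>: "\<pi> permutes A" "\<forall>i\<in>A. \<phi> i = \<psi> (\<pi> i)" by blast
    have "exponent_mapping A \<phi> = Poly_Mapping.map_key \<pi> (exponent_mapping A \<psi>)"
      by (rule poly_mapping_eqI)
        (use \<pi> permutes_in_image[OF \<pi>(1)] in \<open>auto simp: lookup_exponent_mapping[OF A] map_key.rep_eq[OF permutes_inj[OF \<pi>(1)]]\<close>)
    moreover have "permute_vars \<pi> S = S"
      using assms \<pi>(1) unfolding symmetric_mpoly_def A_def by blast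
    ultimately show ?thesis
      unfolding s_def using lookup_permute_vars[OF permutes_bij[OF \<pi>(1)], of S] by metis
  qed
  \<comment> \<open>Any vector of weight \<open>w\<close> may be chosen, by the constancy just
    shown.\<close>
  define c where "c = (\<lambda>w. s (SOME \<phi>. \<phi> \<in> E \<and> wt \<phi> = w))"
  have c: "c (wt \<phi>) = s \<phi>" if "\<phi> \<in> E" for \<phi>
  proof -
    have "(SOME \<psi>. \<psi> \<in> E \<and> wt \<psi> = wt \<phi>) \<in> E \<and> wt (SOME \<psi>. \<psi> \<in> E \<and> wt \<psi> = wt \<phi>) = wt \<phi>"
      using that by (intro someI_ex[of "\<lambda>\<psi>. \<psi> \<in> E \<and> wt \<psi> = wt \<phi>"]) blast
    then show ?thesis unfolding c_def using s that by blast
  qed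
  have "mpoly_eval x S =
      (\<Sum>w\<in>wt ` E. of_int (c w) * Polynomial.coeff (\<Prod>i\<in>A. weight_poly N B (x i)) w)" for x
  proof -
    let ?t = "\<lambda>\<phi>. of_int (s \<phi>) * (\<Prod>i\<in>A. x i ^ \<phi> i)"
    have "mpoly_eval x S = (\<Sum>\<phi>\<in>E. ?t \<phi>)"
      unfolding s_def E_def by (rule mpoly_eval_exponents[OF vars A N])
    also have "\<dots> = (\<Sum>w\<in>wt ` E. \<Sum>\<phi>\<in>{\<phi> \<in> E. wt \<phi> = w}. ?t \<phi>)"
      using E by (subst sum.group) auto
    also have "\<dots> = (\<Sum>w\<in>wt ` E. of_int (c w) * (\<Sum>\<phi>\<in>{\<phi> \<in> E. wt \<phi> = w}. \<Prod>i\<in>A. x i ^ \<phi> i))"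
    proof (intro sum.cong refl)
      fix w
      show "(\<Sum>\<phi>\<in>{\<phi> \<in> E. wt \<phi> = w}. ?t \<phi>)
          = of_int (c w) * (\<Sum>\<phi>\<in>{\<phi> \<in> E. wt \<phi> = w}. \<Prod>i\<in>A. x i ^ \<phi> i)"
        unfolding sum_distrib_left by (rule sum.cong) (auto simp: c[symmetric])
    qed
    also have "\<dots> = (\<Sum>w\<in>wt ` E. of_int (c w) * Polynomial.coeff (\<Prod>i\<in>A. weight_poly N B (x i)) w)"
      unfolding prod_weight_poly[OF A] Polynomial.coeff_sum Polynomial.coeff_monom E_def[symmetric]
      using E by (simp add: wt_def sum.If_cases Int_def conj_commute)
    finally show ?thesis .
  qed
  then show ?thesis using E unfolding A_def by (intro exI[of _ N] exI[of _ B] exI[of _ "wt ` E"] exI[of _ c]) auto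
qed


section \<open>Lifting the factorization to the integers\<close>

lemma ideal_cong_pcompose:
  assumes "ideal_cong m G p q"
  shows "ideal_cong m G (pcompose h p) (pcompose h q)"
proof (induction h)
  case (pCons a h)
  have "ideal_cong m G (p * pcompose h p) (p * pcompose h q)"
    using pCons by (intro ideal_cong_mult_left) auto
  moreover have "ideal_cong m G (pcompose h q * p) (pcompose h q * q)"
    using assms by (rule ideal_cong_mult_left)
  ultimately have "ideal_cong m G (p * pcompose h p) (q * pcompose h q)"
    unfolding mult.commute[of "pcompose h q"] by (rule ideal_cong_trans)
  then show ?case unfolding pcompose_pCons by (intro ideal_cong_add) auto
qed simp

lemma int_poly_smultI:
  assumes "\<And>i. int n dvd Polynomial.coeff p i"
  shows "\<exists>k. p = Polynomial.smult (int n) k"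
proof -
  have "[:int n:] dvd p" using assms by (simp add: const_poly_dvd_iff)
  then show ?thesis by (auto elim!: dvdE)
qed

section \<open>Reduction modulo \<open>n\<close> as a ring homomorphism\<close>

context
  fixes n :: nat
  assumes n: "n > 1"
begin

private abbreviation (input) R where "R \<equiv> residue_ring (int n)"
private abbreviation (input) P where "P \<equiv> UP R"
private abbreviation (input) \<rho> where "\<rho> \<equiv> reduce_poly n"

interpretation residues "int n" R
  by unfold_locales (use n in simp)

interpretation UP_cring R P
  by unfold_locales

lemma reduce_poly_in: "\<rho> f \<in> carrier P" "\<rho> f \<in> up R"
  using reduce_poly_carrier[of n f] n by (auto simp: UP_def)

lemma reduce_poly_add: "\<rho> (f + g) = \<rho> f \<oplus>\<^bsub>P\<^esub> \<rho> g"
  using reduce_poly_in(2) by (auto simp: UP_def res_add_eq reduce_poly_def mod_add_eq)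

lemma reduce_poly_mult: "\<rho> (f * g) = \<rho> f \<otimes>\<^bsub>P\<^esub> \<rho> g"
proof
  fix i
  have "(\<rho> f \<otimes>\<^bsub>P\<^esub> \<rho> g) i = (\<Oplus>\<^bsub>R\<^esub>j\<in>{..i}. \<rho> f j \<otimes>\<^bsub>R\<^esub> \<rho> g (i - j))"
    using reduce_poly_in(2) by (simp add: UP_def)
  also have "\<dots> = (\<Oplus>\<^bsub>R\<^esub>j\<in>{..i}. (Polynomial.coeff f j * Polynomial.coeff g (i - j)) mod int n)"
    unfolding reduce_poly_def mult_cong ..
  also have "\<dots> = \<rho> (f * g) i"
    by (simp add: sum_cong reduce_poly_def Polynomial.coeff_mult)
  finally show "\<rho> (f * g) i = (\<rho> f \<otimes>\<^bsub>P\<^esub> \<rho> g) i" ..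
qed

lemma reduce_poly_zero: "\<rho> 0 = \<zero>\<^bsub>P\<^esub>"
  by (simp add: UP_def reduce_poly_def res_zero_eq)

lemma reduce_poly_one: "\<rho> 1 = \<one>\<^bsub>P\<^esub>"
  using n by (auto simp: UP_def reduce_poly_def res_zero_eq res_one_eq)

lemma reduce_poly_monom: "\<rho> (Polynomial.monom a i) = UnivPoly.monom P (a mod int n) i"
  using n by (auto simp: UP_def reduce_poly_def res_zero_eq res_carrier_eq Polynomial.coeff_monom)

lemma reduce_poly_minus: "\<rho> (f - g) = \<rho> f \<ominus>\<^bsub>P\<^esub> \<rho> g"
proof -
  have "\<rho> f = \<rho> (f - g) \<oplus>\<^bsub>P\<^esub> \<rho> g" by (simp flip: reduce_poly_add)
  then show ?thesis
    using reduce_poly_in(1) by (simp add: P.minus_eq P.a_assoc P.r_neg)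
qed

lemma reduce_poly_power: "\<rho> (f ^ i) = \<rho> f [^]\<^bsub>P\<^esub> i"
  by (induction i) (simp_all add: reduce_poly_one reduce_poly_mult mult.commute[of f])

lemma reduce_poly_sum:
  "finite A \<Longrightarrow> \<rho> (\<Sum>i\<in>A. f i) = (\<Oplus>\<^bsub>P\<^esub>i\<in>A. \<rho> (f i))"
  by (induction A rule: finite_induct)
    (auto simp: reduce_poly_zero reduce_poly_add reduce_poly_in(1) P.finsum_insert)

lemma reduce_poly_eqD:
  assumes "\<rho> f = \<rho> g"
  shows "\<exists>k. f - g = Polynomial.smult (int n) k"
proof (rule int_poly_smultI)
  fix i
  have "Polynomial.coeff f i mod int n = Polynomial.coeff g i mod int n"
    using fun_cong[OF assms, of i] by (simp add: reduce_poly_def)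
  then show "int n dvd Polynomial.coeff (f - g) i" by (simp add: mod_eq_dvd_iff)
qed

text \<open>The residues are integers in \<open>{0..n - 1}\<close>, so the coefficient sequence of
  \<open>p\<close> already is that of an integer polynomial. Keeping the coefficients unchanged lets
  monic polynomials lift to monic ones of the same degree.\<close>

lemma reduce_poly_coeff_surj:
  assumes "p \<in> carrier P"
  shows "\<exists>f. \<rho> f = p \<and> (\<forall>i. Polynomial.coeff f i = p i)"
proof -
  have p: "p i \<in> {0..int n - 1}" for i
    using assms by (auto simp: UP_def up_def res_carrier_eq)
  obtain m where "bound \<zero>\<^bsub>R\<^esub> m p" using assms by (auto simp: UP_def up_def)
  then have "Polynomial.coeff (Abs_poly p) i = p i" for i
    by (intro coeff_Abs_poly[of m p, THEN fun_cong]) (auto simp: bound_def res_zero_eq)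
  moreover from this have "\<rho> (Abs_poly p) = p"
    using p by (auto simp: reduce_poly_def fun_eq_iff)
  ultimately show ?thesis by blast
qed

lemma coeff_UP: "p \<in> carrier P \<Longrightarrow> UnivPoly.coeff P p i = p i"
  by (simp add: UP_def)

lemma up_monic_lift:
  assumes "up_monic R p"
  shows "\<exists>f. \<rho> f = p \<and> lead_coeff f = 1 \<and> Polynomial.degree f = deg R p"
proof -
  have p: "p \<in> carrier P" "p (deg R p) = 1"
    using assms coeff_UP by (auto simp: up_monic_def res_one_eq)
  obtain f where f: "\<rho> f = p" "\<And>i. Polynomial.coeff f i = p i"
    using reduce_poly_coeff_surj[OF p(1)] by blast
  have "Polynomial.coeff f i = 0" if "i > deg R p" for i
    using deg_aboveD[OF that p(1)] coeff_UP[OF p(1)] f(2) by (simp add: res_zero_eq)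
  then have "Polynomial.degree f = deg R p"
    using p(2) f(2) by (intro antisym degree_le Polynomial.le_degree) auto
  then show ?thesis using f p(2) by metis
qed

text \<open>Composition over \<open>R\<close> sums up to the degree of the reduced polynomial,
  \<open>pcompose\<close> up to the degree of \<open>f\<close>; the hypothesis makes the two ranges
  equal.\<close>

lemma up_compose_reduce_poly:
  assumes "Polynomial.degree f = deg R (\<rho> f)"
  shows "up_compose R (\<rho> f) (\<rho> g) = \<rho> (pcompose f g)"
proof -
  have "pcompose f g = (\<Sum>i\<le>Polynomial.degree f. [:Polynomial.coeff f i:] * g ^ i)"
    by (simp add: pcompose_altdef poly_altdef coeff_map_poly degree_map_poly)
  then have "\<rho> (pcompose f g) = (\<Oplus>\<^bsub>P\<^esub>i\<in>{..Polynomial.degree f}. \<rho> ([:Polynomial.coeff f i:] * g ^ i))"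
    by (simp only: reduce_poly_sum finite_atMost)
  also have "\<dots> = (\<Oplus>\<^bsub>P\<^esub>i\<in>{..Polynomial.degree f}.
      UnivPoly.monom P (UnivPoly.coeff P (\<rho> f) i) 0 \<otimes>\<^bsub>P\<^esub> \<rho> g [^]\<^bsub>P\<^esub> i)"
    unfolding reduce_poly_mult reduce_poly_power coeff_UP[OF reduce_poly_in(1)] monom_0[symmetric] reduce_poly_monom
    unfolding reduce_poly_def ..
  also have "\<dots> = up_compose R (\<rho> f) (\<rho> g)"
    unfolding up_compose_def eval_def assms using reduce_poly_in(1) by simp
  finally show ?thesis ..
qed

text \<open>Lifting the cofactor \<open>x\<close> turns divisibility over the integers modulo
  \<open>n\<close> into membership in the ideal \<open>(G, n)\<close> of
  \<open>\<int>[x]\<close>.\<close>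

lemma divides_imp_ideal_cong:
  assumes "\<rho> p = x \<otimes>\<^bsub>P\<^esub> \<rho> G" "x \<in> carrier P"
  shows "ideal_cong (int n) G p 0"
proof -
  obtain u where "x = \<rho> u" using reduce_poly_coeff_surj[OF assms(2)] by blast
  then have "\<rho> p = \<rho> (G * u)" using assms(1) by (simp add: reduce_poly_mult mult.commute[of G])
  then obtain v where "p - G * u = Polynomial.smult (int n) v" using reduce_poly_eqD by blast
  then show ?thesis by (intro ideal_congI[of _ _ _ u _ v]) (simp add: algebra_simps)
qed

text \<open>Each \<open>F i\<close> lifts to a monic \<open>G i\<close> of the same degree. The
  product equations telescope down to \<open>fs d\<close>, which is one, and the gcmd and Frobenius
  conditions become the two congruences for \<open>G i\<close>.\<close>

lemma frobenius_factorization_lift: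
  assumes "factorization_step f n F fs" "frobenius_step f n F"
  shows "\<exists>G k. f - (\<Prod>i\<in>{1..Polynomial.degree f}. G i) = Polynomial.smult (int n) k \<and>
    (\<forall>i\<in>{1..Polynomial.degree f}. lead_coeff (G i) = 1 \<and>
       ideal_cong (int n) (G i) (pcompose (G i) (Polynomial.monom 1 n)) 0 \<and>
       ideal_cong (int n) (G i) (Polynomial.monom 1 (n ^ i)) (Polynomial.monom 1 1))"
proof -
  define d where "d = Polynomial.degree f"
  have X: "UnivPoly.monom P \<one>\<^bsub>R\<^esub> i = \<rho> (Polynomial.monom 1 i)" for i
    using n by (simp add: reduce_poly_monom res_one_eq)
  have fs: "fs 0 = \<rho> f" "fs d = \<one>\<^bsub>P\<^esub>"
      "\<And>i. i \<in> {1..d} \<Longrightarrow> fs i \<in> carrier P \<and> fs (i - 1) = F i \<otimes>\<^bsub>P\<^esub> fs i"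
    and gcmd: "\<And>i. i \<in> {1..d} \<Longrightarrow>
      is_gcmd R (\<rho> (Polynomial.monom 1 (n ^ i)) \<ominus>\<^bsub>P\<^esub> \<rho> (Polynomial.monom 1 1)) (fs (i - 1)) (F i)"
    using assms(1) unfolding factorization_step_def Let_def d_def X by blast+
  have "\<forall>i. \<exists>g. i \<in> {1..d} \<longrightarrow> \<rho> g = F i \<and> lead_coeff g = 1 \<and> Polynomial.degree g = deg R (F i)"
    using gcmd up_monic_lift unfolding is_gcmd_def by meson
  then obtain G where G: "\<And>i. i \<in> {1..d} \<Longrightarrow> \<rho> (G i) = F i" "\<And>i. i \<in> {1..d} \<Longrightarrow> lead_coeff (G i) = 1"
      "\<And>i. i \<in> {1..d} \<Longrightarrow> Polynomial.degree (G i) = deg R (F i)" by metis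
  have fs_in: "fs i \<in> carrier P" if "i \<le> d" for i
    using fs(1) fs(3)[of i] reduce_poly_in(1) that by (cases "i = 0") auto
  have "fs 0 = \<rho> (\<Prod>i\<in>{1..j}. G i) \<otimes>\<^bsub>P\<^esub> fs j" if "j \<le> d" for j
    using that
  proof (induction j)
    case 0
    then show ?case using fs_in[of 0] by (simp add: reduce_poly_one)
  next
    case (Suc j)
    then have "fs 0 = \<rho> (\<Prod>i\<in>{1..j}. G i) \<otimes>\<^bsub>P\<^esub> (\<rho> (G (Suc j)) \<otimes>\<^bsub>P\<^esub> fs (Suc j))"
      using fs(3)[of "Suc j"] G(1)[of "Suc j"] by simp
    also have "\<dots> = \<rho> (\<Prod>i\<in>{1..Suc j}. G i) \<otimes>\<^bsub>P\<^esub> fs (Suc j)"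
      using reduce_poly_in(1) fs_in[OF Suc.prems]
      by (simp add: P.m_assoc reduce_poly_mult[symmetric] flip: P.m_assoc)
    finally show ?case .
  qed
  from this[of d] have "\<rho> f = \<rho> (\<Prod>i\<in>{1..d}. G i)"
    using fs reduce_poly_in(1) by simp
  then obtain k where "f - (\<Prod>i\<in>{1..d}. G i) = Polynomial.smult (int n) k"
    using reduce_poly_eqD by blast
  moreover have pow: "ideal_cong (int n) (G i) (Polynomial.monom 1 (n ^ i)) (Polynomial.monom 1 1)"
    if i: "i \<in> {1..d}" for i
  proof -
    let ?x = "\<rho> (Polynomial.monom 1 (n ^ i) - Polynomial.monom 1 1)"
    have "i - 1 \<le> d" using i by auto
    then have "{?x, fs (i - 1)} \<subseteq> carrier P" using fs_in reduce_poly_in(1) by simp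
    \<comment> \<open>\<open>?x\<close> is one of the two generators of the ideal that the gcmd
      condition identifies with the principal ideal of \<open>F i\<close>.\<close>
    then have "?x \<in> Idl\<^bsub>P\<^esub> {?x, fs (i - 1)}" using P.genideal_self by blast
    also have "\<dots> = PIdl\<^bsub>P\<^esub> (F i)"
      using gcmd[OF i] G(1)[OF i] reduce_poly_in(1) unfolding is_gcmd_def reduce_poly_minus
      by (metis P.cgenideal_eq_genideal)
    finally obtain y where "y \<in> carrier P" "?x = y \<otimes>\<^bsub>P\<^esub> \<rho> (G i)"
      unfolding cgenideal_def G(1)[OF i] by blast
    then show ?thesis using divides_imp_ideal_cong unfolding ideal_cong_def by fastforce
  qed
  moreover have "ideal_cong (int n) (G i) (pcompose (G i) (Polynomial.monom 1 n)) 0"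
    if i: "i \<in> {1..d}" for i
  proof (cases "i = 1")
    \<comment> \<open>The Frobenius condition starts at \<open>i = 2\<close>. For
      \<open>i = 1\<close> the congruence of \<open>x^n\<close> with \<open>x\<close> already gives
      that of \<open>G(x^n)\<close> with \<open>G(x)\<close>.\<close>
    case True
    have "pcompose (G i) (Polynomial.monom 1 1) = G i" by (simp add: monom_altdef)
    then have "ideal_cong (int n) (G i) (pcompose (G i) (Polynomial.monom 1 n)) (G i)"
      using ideal_cong_pcompose[OF pow[OF i], of "G i"] True by simp
    moreover have "ideal_cong (int n) (G i) (G i) 0" by (rule ideal_congI[of _ _ _ 1 _ 0]) simp
    ultimately show ?thesis by (rule ideal_cong_trans)
  next
    case False
    then have "F i divides\<^bsub>P\<^esub> up_compose R (F i) (\<rho> (Polynomial.monom 1 n))"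
      using assms(2) i unfolding frobenius_step_def Let_def X d_def by auto
    then have "\<rho> (G i) divides\<^bsub>P\<^esub> \<rho> (pcompose (G i) (Polynomial.monom 1 n))"
      using up_compose_reduce_poly[of "G i" "Polynomial.monom 1 n"] G(1,3)[OF i] by simp
    then obtain x where "x \<in> carrier P" "\<rho> (pcompose (G i) (Polynomial.monom 1 n)) = x \<otimes>\<^bsub>P\<^esub> \<rho> (G i)"
      using reduce_poly_in(1) P.m_comm by (auto elim!: dividesE)
    then show ?thesis using divides_imp_ideal_cong by blast
  qed
  ultimately show ?thesis using G(2) unfolding d_def by blast
qed

end


section \<open>Norms as generating polynomials of symmetric functions\<close>

text \<open>\<open>h\<close> is the sum of the \<open>t^(B^j) * x^j\<close> with \<open>x\<close> as
  outer variable. Evaluation at a constant root leaves a polynomial in \<open>t\<close>, and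
  replacing \<open>x\<close> by \<open>x^n\<close> in \<open>h\<close> amounts to raising the root
  to the power \<open>n\<close>.\<close>

lemma poly_weight_polynomial:
  fixes x :: complex and N B :: nat
  defines "h \<equiv> (\<Sum>j\<le>N. Polynomial.monom (Polynomial.monom 1 (B ^ j)) j) :: int poly poly"
  shows "poly (map_poly of_int_poly h) [:x:] = weight_poly N B x"
    "poly (map_poly of_int_poly (pcompose h (Polynomial.monom 1 n))) [:x:] = weight_poly N B (x ^ n)"
proof -
  interpret MH: map_poly_idom_hom "of_int_poly :: int poly \<Rightarrow> complex poly" ..
  have pow: "[:y:] ^ j = [:y ^ j:]" for y :: complex and j
    by (induction j) (simp_all add: pCons_one)
  have h: "poly (map_poly of_int_poly h) [:y:] = weight_poly N B y" for y :: complex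
    unfolding h_def weight_poly_def
    by (simp add: MH.hom_sum map_poly_monom poly_sum poly_monom pow smult_monom mult.commute)
  show "poly (map_poly of_int_poly h) [:x:] = weight_poly N B x" by (rule h)
  have "poly (map_poly of_int_poly (pcompose h (Polynomial.monom 1 n))) [:x:]
      = poly (map_poly of_int_poly h) ([:x:] ^ n)"
    by (simp add: of_int_poly_hom.map_poly_pcompose poly_pcompose map_poly_monom poly_monom)
  then show "poly (map_poly of_int_poly (pcompose h (Polynomial.monom 1 n))) [:x:] = weight_poly N B (x ^ n)"
    unfolding pow h .
qed

theorem theorem4p12:
  fixes f :: "int poly" and k n :: nat and \<beta> :: "nat \<Rightarrow> complex"
  assumes "lead_coeff f = 1"
    and "squarefree f"
    and "map_poly of_int f = (\<Prod>i=1..k. [:- \<beta> i, 1:])"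
    and "frobenius_pseudoprime f n"
  shows "szekeres_pseudoprime k \<beta> n"
  unfolding szekeres_pseudoprime_def
proof (intro allI impI)
  fix S assume S: "symmetric_mpoly k S"
  obtain F fs where n: "n > 1" and F: "factorization_step f n F fs" "frobenius_step f n F"
    using assms(4) unfolding frobenius_pseudoprime_def frobenius_probable_prime_def by blast
  obtain G l where l: "f - (\<Prod>i\<in>{1..Polynomial.degree f}. G i) = Polynomial.smult (int n) l"
    and G: "\<And>i. i \<in> {1..Polynomial.degree f} \<Longrightarrow> lead_coeff (G i) = 1"
      "\<And>i. i \<in> {1..Polynomial.degree f} \<Longrightarrow>
         ideal_cong (int n) (G i) (pcompose (G i) (Polynomial.monom 1 n)) 0"
      "\<And>i. i \<in> {1..Polynomial.degree f} \<Longrightarrow>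
         ideal_cong (int n) (G i) (Polynomial.monom 1 (n ^ i)) (Polynomial.monom 1 1)"
    using frobenius_factorization_lift[OF n F] by blast
  obtain N B W c where W: "finite (W :: nat set)" and
    eval: "\<And>x. mpoly_eval x S =
       (\<Sum>w\<in>W. of_int (c w) * Polynomial.coeff (\<Prod>i\<in>{1..k}. weight_poly N B (x i)) w)"
    using symmetric_mpoly_eval[OF S] by blast
  define h :: "int poly poly" where "h = (\<Sum>j\<le>N. Polynomial.monom (Polynomial.monom 1 (B ^ j)) j)"
  define D where "D = mult_det (of_int_poly f) h"
  define D' where "D' = mult_det (of_int_poly f) (pcompose h (Polynomial.monom 1 n))"
  have "of_nat n dvd D - D'"
    unfolding D_def D'_def
  proof (rule mult_det_frobenius_cong[OF n assms(1) finite_atLeastAtMost l G(1,2)])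
    fix i assume "i \<in> {1..Polynomial.degree f}"
    then show "\<exists>e>0. ideal_cong (int n) (G i) (Polynomial.monom 1 (n ^ e)) (Polynomial.monom 1 1)"
      using G(3) by (intro exI[of _ i]) auto
  qed
  \<comment> \<open>Here \<open>n\<close> is a constant polynomial in \<open>t\<close>, so
    divisibility holds coefficient by coefficient.\<close>
  then have cong: "int n dvd Polynomial.coeff D w - Polynomial.coeff D' w" for w
    by (simp add: of_nat_poly const_poly_dvd_iff)
  define A where "A = image_mset \<beta> (mset_set {1..k})"
  have A: "of_int_poly f = (\<Prod>x\<in>#A. [:- x, 1:])"
    unfolding A_def assms(3) by (simp add: image_mset.compositionality comp_def prod_unfold_prod_mset)
  have "of_int_poly D = (\<Prod>x\<in>#A. weight_poly N B x)"
    "of_int_poly D' = (\<Prod>x\<in>#A. weight_poly N B (x ^ n))"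
    unfolding D_def D'_def complex_mult_det_prod_roots[OF assms(1) A] h_def poly_weight_polynomial
    by (rule refl)+
  then have D: "of_int_poly D = (\<Prod>i\<in>{1..k}. weight_poly N B (\<beta> i))"
    "of_int_poly D' = (\<Prod>i\<in>{1..k}. weight_poly N B (\<beta> i ^ n))"
    unfolding A_def by (simp_all add: image_mset.compositionality comp_def prod_unfold_prod_mset)
  \<comment> \<open>The same integers \<open>c w\<close> serve for both root tuples, so both values
    are integers, and their difference is a combination of differences of coefficients of
    \<open>D\<close> and \<open>D'\<close>.\<close>
  let ?val = "\<lambda>D. \<Sum>w\<in>W. c w * Polynomial.coeff D w"
  have "mpoly_eval \<beta> S = of_int (?val D)" "mpoly_eval (\<lambda>i. \<beta> i ^ n) S = of_int (?val D')"
    unfolding eval D[symmetric] by (simp_all add: coeff_map_poly)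
  moreover have "[?val D' = ?val D] (mod int n)"
  proof -
    have "int n dvd ?val D - ?val D'"
      unfolding sum_subtractf[symmetric] right_diff_distrib[symmetric]
      by (intro dvd_sum dvd_mult cong)
    then show ?thesis by (simp add: cong_iff_dvd_diff dvd_diff_commute)
  qed
  ultimately show "\<exists>a b :: int. mpoly_eval (\<lambda>i. \<beta> i ^ n) S = of_int a \<and> mpoly_eval \<beta> S = of_int b \<and>
      [a = b] (mod int n)"
    by blast
qed

end
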